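(* There does not exist a unique factorization domain $R$ of finite character and of Krull dimension $2$ such that the polynomial ring $R[X]$ is radically finite.
   Context: All rings are commutative with identity. A ring $R$ is of finite character if every nonzero element of $R$ is contained in only finitely many maximal ideals. An ideal $I$ of a ring $S$ is called radically perfect if $\mathrm{ht}(I)=\inf\{n \mid \sqrt{I}=\sqrt{(\theta_1,\dots,\theta_n)} \text{ for some } \theta_1,\dots,\theta_n\in S\}$, and moreover, if $\mathrm{ht}(I)=0$, then $\sqrt{I}=\sqrt{(\theta)}$ for some zero divisor $\theta$ of $S$. A ring $S$ is called radically finite if every prime ideal $P$ of $S$ is radically perfect and, in addition, the set of ideals of $S$ that are generated by $\mathrm{ht}(P)$ elements and have radical $P$ has a maximal member $A$ such that there are only finitely many ideals in any chain of ideals between $A$ and $P$. *)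

theory Defs
  imports "HOL-Computational_Algebra.Polynomial" "HOL-Computational_Algebra.Factorial_Ring"
    "HOL-Library.Extended_Nat"
begin

definition is_ideal :: "'a::comm_ring_1 set \<Rightarrow> bool" where
  "is_ideal I \<longleftrightarrow> 0 \<in> I \<and> (\<forall>x\<in>I. \<forall>y\<in>I. x + y \<in> I) \<and> (\<forall>r. \<forall>x\<in>I. r * x \<in> I)"

definition prime_ideal :: "'a::comm_ring_1 set \<Rightarrow> bool" where
  "prime_ideal P \<longleftrightarrow> is_ideal P \<and> P \<noteq> UNIV \<and> (\<forall>x y. x * y \<in> P \<longrightarrow> x \<in> P \<or> y \<in> P)"

definition maximal_ideal :: "'a::comm_ring_1 set \<Rightarrow> bool" where
  "maximal_ideal M \<longleftrightarrow> is_ideal M \<and> M \<noteq> UNIV \<and>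
     (\<forall>J. is_ideal J \<longrightarrow> M \<subseteq> J \<longrightarrow> J = M \<or> J = UNIV)"

definition rad :: "'a::comm_ring_1 set \<Rightarrow> 'a set" where
  "rad I = {x. \<exists>n::nat. x ^ n \<in> I}"

definition gen_ideal :: "'a::comm_ring_1 set \<Rightarrow> 'a set" where
  "gen_ideal S = \<Inter>{I. is_ideal I \<and> S \<subseteq> I}"

definition gen_by :: "nat \<Rightarrow> (nat \<Rightarrow> 'a::comm_ring_1) \<Rightarrow> 'a set" where
  "gen_by n \<theta> = gen_ideal (\<theta> ` {..<n})"

text \<open>Zero divisor (inclusive convention: 0 is a zero divisor of a nonzero ring).\<close>
definition zero_divisor :: "'a::comm_ring_1 \<Rightarrow> bool" where
  "zero_divisor a \<longleftrightarrow> (\<exists>b. b \<noteq> 0 \<and> a * b = 0)"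

definition prime_height :: "'a::comm_ring_1 set \<Rightarrow> enat" where
  "prime_height P = Sup {enat n | n. \<exists>f :: nat \<Rightarrow> 'a set.
      (\<forall>i\<le>n. prime_ideal (f i)) \<and> (\<forall>i<n. f i \<subset> f (Suc i)) \<and> f n = P}"

definition ht :: "'a::comm_ring_1 set \<Rightarrow> enat" where
  "ht I = (INF P \<in> {P. prime_ideal P \<and> I \<subseteq> P}. prime_height P)"

definition krull_dim :: "'a::comm_ring_1 itself \<Rightarrow> enat" where
  "krull_dim _ = (SUP P \<in> {P :: 'a set. prime_ideal P}. prime_height P)"

definition finite_character :: "'a::comm_ring_1 itself \<Rightarrow> bool" where
  "finite_character _ \<longleftrightarrow> (\<forall>x::'a. x \<noteq> 0 \<longrightarrow> finite {M. maximal_ideal M \<and> x \<in> M})"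

definition radically_perfect :: "'a::comm_ring_1 set \<Rightarrow> bool" where
  "radically_perfect I \<longleftrightarrow>
     ht I = (INF n \<in> {n. \<exists>\<theta>. rad I = rad (gen_by n \<theta>)}. enat n) \<and>
     (ht I = 0 \<longrightarrow> (\<exists>\<theta>. zero_divisor \<theta> \<and> rad I = rad (gen_ideal {\<theta>})))"

definition radically_finite :: "'a::comm_ring_1 itself \<Rightarrow> bool" where
  "radically_finite _ \<longleftrightarrow> (\<forall>P :: 'a set. prime_ideal P \<longrightarrow>
     radically_perfect P \<and>
     (let S = {J. \<exists>n \<theta>. ht P = enat n \<and> J = gen_by n \<theta> \<and> rad J = P} in
      \<exists>A \<in> S. (\<forall>J\<in>S. A \<subseteq> J \<longrightarrow> J = A) \<and>
        (\<forall>C. (\<forall>J\<in>C. is_ideal J \<and> A \<subseteq> J \<and> J \<subseteq> P) \<and>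
             (\<forall>J1\<in>C. \<forall>J2\<in>C. J1 \<subseteq> J2 \<or> J2 \<subseteq> J1) \<longrightarrow> finite C)))"

end

theory Submission
  imports Defs
begin

text \<open>
  Let \<open>M\<close> be a maximal ideal of height 2 of \<open>R\<close>. By finite character \<open>M\<close> is the radical of a
  two-generated ideal, so \<open>(M, X)\<close> is the radical of a three-generated one. As \<open>R[X]\<close> is radically
  finite, \<open>(M, X)\<close> has height at most 3, and every prime \<open>P\<close> strictly below it has height at
  most 2. Such a \<open>P\<close> contains an ideal \<open>A = (f, g)\<close> with radical \<open>P\<close> and \<open>P / A\<close> of finite length.
  If \<open>A \<noteq> P\<close>, some element of \<open>P\<close> outside \<open>A\<close> is annihilated modulo \<open>A\<close> by a maximal ideal;
  this is impossible when that maximal ideal contains a regular sequence of length 3 (the depth of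
  \<open>R[X] / (f, g)\<close> is then positive). Hence \<open>P = (f, g)\<close>.

  For \<open>P = M[X]\<close> this yields \<open>M = (a, b)\<close>. Then \<open>a^4 - b^3\<close> has a unique prime factor \<open>p\<close> in \<open>M\<close>,
  and the analogue of the monomial curve \<open>(t^3, t^4, t^5)\<close>, the kernel of
  \<open>R[X] \<rightarrow> Frac (R / p)\<close>, \<open>X \<mapsto> a^3 / b\<close>, is a prime that should also be two-generated. But
  \<open>X^2 - a^2 b\<close>, \<open>a X - b^2\<close>, \<open>b X - a^3\<close> are independent in it modulo \<open>(M, X)\<close>, a contradiction.
\<close>

section \<open>Ideals\<close>

lemma is_ideal_0: "is_ideal I \<Longrightarrow> 0 \<in> I"
  by (simp add: is_ideal_def)

lemma is_ideal_add: "is_ideal I \<Longrightarrow> x \<in> I \<Longrightarrow> y \<in> I \<Longrightarrow> x + y \<in> I"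
  by (simp add: is_ideal_def)

lemma is_ideal_mult: "is_ideal I \<Longrightarrow> x \<in> I \<Longrightarrow> r * x \<in> I"
  by (simp add: is_ideal_def)

lemma is_ideal_mult2: "is_ideal I \<Longrightarrow> x \<in> I \<Longrightarrow> x * r \<in> I"
  by (metis is_ideal_mult mult.commute)

lemma is_ideal_uminus: "is_ideal I \<Longrightarrow> x \<in> I \<Longrightarrow> - x \<in> I"
  using is_ideal_mult[of I x "-1"] by simp

lemma is_ideal_diff: "is_ideal I \<Longrightarrow> x \<in> I \<Longrightarrow> y \<in> I \<Longrightarrow> x - y \<in> I"
  using is_ideal_add[of I x "-y"] is_ideal_uminus[of I y] by simp

lemma is_ideal_sum: "is_ideal I \<Longrightarrow> (\<And>i. i \<in> S \<Longrightarrow> f i \<in> I) \<Longrightarrow> sum f S \<in> I"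
  by (induction S rule: infinite_finite_induct) (auto simp: is_ideal_0 is_ideal_add)

lemma is_ideal_UNIV_iff: "is_ideal I \<Longrightarrow> I = UNIV \<longleftrightarrow> 1 \<in> I"
  using is_ideal_mult[of I 1] by auto

lemma is_ideal_adjoin:
  assumes A: "is_ideal A"
  shows "is_ideal {z. \<exists>r. z - r * x \<in> A}"
  unfolding is_ideal_def
proof (intro conjI ballI allI)
  show "0 \<in> {z. \<exists>r. z - r * x \<in> A}" using is_ideal_0[OF A] by (auto intro: exI[of _ 0])
next
  fix u v assume "u \<in> {z. \<exists>r. z - r * x \<in> A}" "v \<in> {z. \<exists>r. z - r * x \<in> A}"
  then obtain r r' where "u - r * x \<in> A" "v - r' * x \<in> A" by blast
  from is_ideal_add[OF A this] show "u + v \<in> {z. \<exists>r. z - r * x \<in> A}"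
    by (auto intro!: exI[of _ "r + r'"] simp: algebra_simps)
next
  fix t u assume "u \<in> {z. \<exists>r. z - r * x \<in> A}"
  then obtain r where "u - r * x \<in> A" by blast
  from is_ideal_mult[OF A this, of t] show "t * u \<in> {z. \<exists>r. z - r * x \<in> A}"
    by (auto intro!: exI[of _ "t * r"] simp: algebra_simps)
qed

section \<open>Prime ideals, radicals and generated ideals\<close>

lemma prime_idealD:
  assumes "prime_ideal P"
  shows "is_ideal P" "1 \<notin> P" "x * y \<in> P \<Longrightarrow> x \<in> P \<or> y \<in> P"
  using assms is_ideal_UNIV_iff unfolding prime_ideal_def by blast+

lemma prime_idealI:
  "is_ideal P \<Longrightarrow> 1 \<notin> P \<Longrightarrow> (\<And>x y. x * y \<in> P \<Longrightarrow> x \<in> P \<or> y \<in> P) \<Longrightarrow> prime_ideal P"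
  unfolding prime_ideal_def by blast

lemma prime_ideal_power: "prime_ideal P \<Longrightarrow> x ^ n \<in> P \<Longrightarrow> x \<in> P"
  by (induction n) (auto dest: prime_idealD)

lemma rad_prime_ideal: "prime_ideal P \<Longrightarrow> rad P = P"
  unfolding rad_def by (auto dest: prime_ideal_power intro: exI[of _ 1])

lemma is_ideal_gen_ideal: "is_ideal (gen_ideal S)"
  unfolding gen_ideal_def is_ideal_def by blast

lemma gen_ideal_superset: "S \<subseteq> gen_ideal S"
  unfolding gen_ideal_def by blast

lemma gen_ideal_least: "is_ideal I \<Longrightarrow> S \<subseteq> I \<Longrightarrow> gen_ideal S \<subseteq> I"
  unfolding gen_ideal_def by blast

lemma is_ideal_principal: "is_ideal {x. p dvd (x :: 'a::comm_ring_1)}"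
  unfolding is_ideal_def by auto

lemma prime_ideal_zero: "prime_ideal {0 :: 'a::idom}"
  by (rule prime_idealI) (auto simp: is_ideal_def)

lemma prime_ideal_principal:
  assumes "prime_elem (p :: 'a::{comm_ring_1, semidom})"
  shows "prime_ideal {x. p dvd x}"
  using assms by (intro prime_idealI is_ideal_principal) (auto simp: prime_elem_def)

text \<open>Explicit coefficients allow cofactors to be compared; \<open>gen_ideal_pair\<close>
  identifies this set with the generated ideal.\<close>

definition ideal2 :: "'a::comm_ring_1 \<Rightarrow> 'a \<Rightarrow> 'a set" where
  "ideal2 f g = {u * f + v * g | u v. True}"

lemma ideal2I: "x = u * f + v * g \<Longrightarrow> x \<in> ideal2 f g"
  unfolding ideal2_def by blast

lemma ideal2E:
  assumes "x \<in> ideal2 f g"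
  obtains u v where "x = u * f + v * g"
  using assms unfolding ideal2_def mem_Collect_eq by (elim exE conjE) (rule that)

lemma is_ideal_ideal2: "is_ideal (ideal2 f g)"
proof -
  have "0 \<in> ideal2 f g" by (rule ideal2I[of _ 0 _ 0]) simp
  moreover have "x + y \<in> ideal2 f g" if x: "x \<in> ideal2 f g" and y: "y \<in> ideal2 f g" for x y
  proof -
    obtain u v where "x = u * f + v * g" using x by (rule ideal2E)
    moreover obtain u' v' where "y = u' * f + v' * g" using y by (rule ideal2E)
    ultimately show ?thesis by (intro ideal2I[of _ "u + u'" _ "v + v'"]) (simp add: algebra_simps)
  qed
  moreover have "r * x \<in> ideal2 f g" if x: "x \<in> ideal2 f g" for r x
  proof -
    obtain u v where "x = u * f + v * g" using x by (rule ideal2E)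
    then show ?thesis by (intro ideal2I[of _ "r * u" _ "r * v"]) (simp add: algebra_simps)
  qed
  ultimately show ?thesis unfolding is_ideal_def by blast
qed

lemma ideal2_gens: "f \<in> ideal2 f g" "g \<in> ideal2 f g"
  by (rule ideal2I[of _ 1 _ 0], simp, rule ideal2I[of _ 0 _ 1], simp)

lemma ideal2_least: "is_ideal I \<Longrightarrow> f \<in> I \<Longrightarrow> g \<in> I \<Longrightarrow> ideal2 f g \<subseteq> I"
  unfolding ideal2_def by (auto intro!: is_ideal_add intro: is_ideal_mult)

lemma gen_ideal_pair: "gen_ideal {f, g} = ideal2 f g"
proof
  show "gen_ideal {f, g} \<subseteq> ideal2 f g"
    by (intro gen_ideal_least is_ideal_ideal2) (simp add: ideal2_gens)
  show "ideal2 f g \<subseteq> gen_ideal {f, g}"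
    using gen_ideal_superset[of "{f, g}"] by (intro ideal2_least is_ideal_gen_ideal) auto
qed

lemma gen_ideal_insert_0: "gen_ideal (insert 0 S) = gen_ideal S"
  unfolding gen_ideal_def by (metis (no_types, lifting) insert_subset is_ideal_0)

text \<open>Padding with zero generators lets heights 0, 1 and 2 be treated uniformly.\<close>

lemma gen_by_le_2:
  assumes "n \<le> 2"
  obtains f g where "gen_by n \<theta> = ideal2 f g"
proof -
  consider "n = 0" | "n = 1" | "n = 2" using assms by linarith
  then show thesis
  proof cases
    case 1
    then have "gen_by n \<theta> = gen_ideal (insert 0 (insert 0 {}))"
      by (simp only: gen_ideal_insert_0) (simp add: gen_by_def)
    then show thesis using that gen_ideal_pair by metis
  next
    case 2
    then have "gen_by n \<theta> = gen_ideal (insert 0 {\<theta> 0})"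
      by (simp only: gen_ideal_insert_0) (simp add: gen_by_def lessThan_Suc)
    then show thesis using that gen_ideal_pair by metis
  next
    case 3
    then have "gen_by n \<theta> = gen_ideal {\<theta> 1, \<theta> 0}"
      by (simp add: gen_by_def numeral_2_eq_2 lessThan_Suc)
    then show thesis using that gen_ideal_pair by metis
  qed
qed

text \<open>Zorn's lemma: an ideal maximal among those above \<open>I\<close> that miss a
  multiplicative set is prime. The set \<open>{1}\<close> will give maximal ideals, and the powers
  of \<open>x\<close> the description of the radical by primes.\<close>

lemma ex_prime_ideal_avoiding:
  fixes I :: "'a::comm_ring_1 set"
  assumes I: "is_ideal I" and S1: "1 \<in> S" and Sm: "\<And>x y. x \<in> S \<Longrightarrow> y \<in> S \<Longrightarrow> x * y \<in> S"
    and dis: "I \<inter> S = {}"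
  obtains Q where "prime_ideal Q" "I \<subseteq> Q" "Q \<inter> S = {}"
    "\<And>J. is_ideal J \<Longrightarrow> Q \<subseteq> J \<Longrightarrow> J \<inter> S = {} \<Longrightarrow> J = Q"
proof -
  define \<A> where "\<A> = {J. is_ideal J \<and> I \<subseteq> J \<and> J \<inter> S = {}}"
  have "\<exists>U\<in>\<A>. \<forall>X\<in>\<C>. X \<subseteq> U" if ch: "subset.chain \<A> \<C>" for \<C>
  proof (cases "\<C> = {}")
    case True
    then show ?thesis using I dis unfolding \<A>_def by blast
  next
    case False
    have mem: "is_ideal J" "I \<subseteq> J" "J \<inter> S = {}" if "J \<in> \<C>" for J
      using that ch unfolding subset.chain_def \<A>_def by auto
    have lin: "J \<subseteq> K \<or> K \<subseteq> J" if "J \<in> \<C>" "K \<in> \<C>" for J K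
      using that ch unfolding subset_chain_def by blast
    have "is_ideal (\<Union>\<C>)"
      unfolding is_ideal_def
    proof (intro conjI ballI allI)
      show "0 \<in> \<Union>\<C>" using False mem(1) is_ideal_0 by blast
    next
      fix x y assume "x \<in> \<Union>\<C>" "y \<in> \<Union>\<C>"
      then obtain J K where "J \<in> \<C>" "K \<in> \<C>" "x \<in> J" "y \<in> K" by blast
      then show "x + y \<in> \<Union>\<C>" using lin[of J K] mem(1) is_ideal_add by blast
    next
      fix r x assume "x \<in> \<Union>\<C>"
      then show "r * x \<in> \<Union>\<C>" using mem(1) is_ideal_mult by blast
    qed
    moreover have "I \<subseteq> \<Union>\<C>" "\<Union>\<C> \<inter> S = {}" using False mem by blast+
    ultimately have "\<Union>\<C> \<in> \<A>" unfolding \<A>_def by blast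
    then show ?thesis by blast
  qed
  from subset_Zorn[OF this] obtain Q where Q: "Q \<in> \<A>" and max: "\<And>X. X \<in> \<A> \<Longrightarrow> Q \<subseteq> X \<Longrightarrow> X = Q"
    by (metis)
  have QI: "is_ideal Q" "I \<subseteq> Q" "Q \<inter> S = {}" using Q unfolding \<A>_def by auto
  have max': "J = Q" if "is_ideal J" "Q \<subseteq> J" "J \<inter> S = {}" for J
    using max[of J] that QI unfolding \<A>_def by blast
  \<comment> \<open>By maximality, adjoining an element outside \<open>Q\<close> produces an ideal
    that meets \<open>S\<close>.\<close>
  have *: "\<exists>s\<in>S. \<exists>r. s - r * x \<in> Q" if x: "x \<notin> Q" for x
  proof -
    define J where "J = {z. \<exists>r. z - r * x \<in> Q}"
    have "is_ideal J"
      unfolding J_def by (rule is_ideal_adjoin[OF QI(1)])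
    moreover have "Q \<subseteq> J" unfolding J_def by (auto intro!: exI[of _ 0])
    moreover have "x \<in> J" unfolding J_def using is_ideal_0[OF QI(1)] by (auto intro!: exI[of _ 1])
    ultimately have "J \<inter> S \<noteq> {}" using max'[of J] x by blast
    then show ?thesis unfolding J_def by blast
  qed
  have "prime_ideal Q"
  proof (rule prime_idealI[OF QI(1)])
    show "1 \<notin> Q" using QI(3) S1 by blast
    fix x y assume xy: "x * y \<in> Q"
    show "x \<in> Q \<or> y \<in> Q"
    proof (rule ccontr)
      assume "\<not> (x \<in> Q \<or> y \<in> Q)"
      then obtain s t r r' where st: "s \<in> S" "t \<in> S" "s - r * x \<in> Q" "t - r' * y \<in> Q"
        using * by meson
      have "(s - r * x) * t + (t - r' * y) * (r * x) + r * r' * (x * y) \<in> Q"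
        by (intro is_ideal_add[OF QI(1)] is_ideal_mult2[OF QI(1) st(3)] is_ideal_mult2[OF QI(1) st(4)]
            is_ideal_mult[OF QI(1) xy])
      also have "(s - r * x) * t + (t - r' * y) * (r * x) + r * r' * (x * y) = s * t"
        by (simp add: algebra_simps)
      finally show False using Sm[OF st(1,2)] QI(3) by blast
    qed
  qed
  then show thesis using that QI max' by blast
qed

lemma ex_maximal_ideal:
  fixes I :: "'a::comm_ring_1 set"
  assumes "is_ideal I" "1 \<notin> I"
  obtains Q where "prime_ideal Q" "maximal_ideal Q" "I \<subseteq> Q"
proof -
  obtain Q where Q: "prime_ideal Q" "I \<subseteq> Q" "Q \<inter> {1} = {}"
    "\<And>J. is_ideal J \<Longrightarrow> Q \<subseteq> J \<Longrightarrow> J \<inter> {1} = {} \<Longrightarrow> J = Q"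
    by (rule ex_prime_ideal_avoiding[of I "{1}"]) (use assms in auto)
  have "maximal_ideal Q"
    unfolding maximal_ideal_def
  proof (intro conjI allI impI)
    show "is_ideal Q" using Q(1) by (rule prime_idealD)
    show "Q \<noteq> UNIV" using Q(3) by auto
    fix J assume "is_ideal J" "Q \<subseteq> J"
    then show "J = Q \<or> J = UNIV" using Q(4)[of J] is_ideal_UNIV_iff[of J] by blast
  qed
  then show thesis using that Q by blast
qed

lemma ex_prime_ideal_not_in_rad:
  fixes I :: "'a::comm_ring_1 set"
  assumes "is_ideal I" "x \<notin> rad I"
  obtains Q where "prime_ideal Q" "I \<subseteq> Q" "x \<notin> Q"
proof -
  obtain Q where "prime_ideal Q" "I \<subseteq> Q" "Q \<inter> range (\<lambda>n. x ^ n) = {}"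
  proof (rule ex_prime_ideal_avoiding[of I "range (\<lambda>n. x ^ n)"])
    show "1 \<in> range (\<lambda>n. x ^ n)" by (rule range_eqI[of _ _ 0]) simp
    show "y * z \<in> range (\<lambda>n. x ^ n)" if "y \<in> range (\<lambda>n. x ^ n)" "z \<in> range (\<lambda>n. x ^ n)" for y z
      using that by (auto simp flip: power_add)
    show "I \<inter> range (\<lambda>n. x ^ n) = {}" using assms(2) unfolding rad_def by auto
  qed (use assms in auto)
  moreover have "x \<in> range (\<lambda>n. x ^ n)" by (rule range_eqI[of _ _ 1]) simp
  ultimately show thesis using that by blast
qed

text \<open>Primality of \<open>Q\<close> passes membership from \<open>x\<close> to one of its
  prime factors, by induction along the factorization.\<close>

lemma prime_ideal_contains_prime_elem:
  fixes Q :: "'a :: {factorial_semiring, idom} set"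
  assumes "prime_ideal Q" "x \<in> Q" "x \<noteq> 0"
  obtains p where "prime_elem p" "p dvd x" "p \<in> Q"
proof -
  have "\<exists>p. prime_elem p \<and> p dvd x \<and> p \<in> Q"
    using assms(3,2)
  proof (induction x rule: prime_divisors_induct)
    case zero
    then show ?case by simp
  next
    case (unit x)
    then obtain y where "1 = x * y" by (elim dvdE)
    then show ?case using unit prime_idealD[OF assms(1)] is_ideal_mult2 by metis
  next
    case (factor p x)
    show ?case
    proof (cases "p \<in> Q")
      case True
      then show ?thesis using factor.hyps by (intro exI[of _ p]) (auto simp: prime_def)
    next
      case False
      then have "x \<in> Q" using factor.prems prime_idealD(3)[OF assms(1)] by blast
      then show ?thesis using factor by (metis dvd_mult mult_zero_right)
    qed
  qed
  then show thesis using that by blast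
qed

section \<open>Regular sequences\<close>

text \<open>The implication says that \<open>t\<close> is not a zero divisor modulo
  \<open>s\<close>, so in a domain this is a regular sequence of length two, except that
  \<open>s\<close> and \<open>t\<close> may generate the unit ideal.\<close>

definition reg_pair :: "'a::comm_ring_1 \<Rightarrow> 'a \<Rightarrow> bool" where
  "reg_pair s t \<longleftrightarrow> s \<noteq> 0 \<and> (\<forall>p q. q * s = p * t \<longrightarrow> s dvd p)"

lemma reg_pairD:
  assumes "reg_pair s t" "q * s = p * t"
  shows "s dvd p"
  using assms(1)[unfolded reg_pair_def, THEN conjunct2, rule_format, OF assms(2)] .

text \<open>Powers are allowed because an ideal with radical \<open>P\<close> is only known to
  contain powers of given elements of \<open>P\<close>. The induction cancels one factor
  \<open>s\<close> at a time.\<close>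

lemma prime_elem_imp_reg_pair:
  fixes s t :: "'a::idom"
  assumes s: "prime_elem s" and st: "\<not> s dvd t"
  shows "reg_pair (s ^ k) (t ^ l)"
proof -
  have "s ^ k dvd p" if "s ^ k dvd p * t ^ l" for p
    using that
  proof (induction k arbitrary: p)
    case 0
    then show ?case by simp
  next
    case (Suc k)
    have "s dvd s ^ Suc k" by simp
    then have "s dvd p * t ^ l" using Suc.prems by (rule dvd_trans)
    then have "s dvd p \<or> s dvd t ^ l" using s unfolding prime_elem_def by blast
    then have "s dvd p" using prime_elem_dvd_power[OF s] st by blast
    then obtain p' where p': "p = s * p'" by (elim dvdE)
    have "s \<noteq> 0" using s unfolding prime_elem_def by blast
    moreover have "s * s ^ k dvd s * (p' * t ^ l)" using Suc.prems unfolding p' by (simp only: power_Suc mult.assoc)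
    ultimately have "s ^ k dvd p' * t ^ l" using dvd_mult_cancel_left by blast
    then have "s ^ k dvd p'" by (rule Suc.IH)
    then show ?case unfolding p' power_Suc by (rule mult_dvd_mono[OF dvd_refl])
  qed
  moreover have "s ^ k \<noteq> 0" using s by (simp add: prime_elem_def)
  ultimately show ?thesis
    unfolding reg_pair_def by (metis dvdI mult.commute)
qed

text \<open>An ideal \<open>(f, g)\<close> that contains a regular pair has only Koszul relations.
  The fraction \<open>w = v / f\<close> satisfies \<open>w * s = p\<close> and
  \<open>w * t = q\<close> with \<open>p\<close>, \<open>q\<close> in the ring, so
  \<open>q * s = p * t\<close>; regularity gives \<open>s dvd p\<close>, and hence \<open>w\<close>
  lies in the ring.\<close>

lemma reg_pair_syzygy:
  fixes f g :: "'a::idom"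
  assumes st: "reg_pair s t" "s \<in> ideal2 f g" "t \<in> ideal2 f g" and f: "f \<noteq> 0"
    and uv: "u * f + v * g = 0"
  obtains w where "v = w * f" "u = - (w * g)"
proof -
  obtain \<alpha> \<beta> where s: "s = \<alpha> * f + \<beta> * g" using st(2) by (rule ideal2E)
  obtain \<gamma> \<delta> where t: "t = \<gamma> * f + \<delta> * g" using st(3) by (rule ideal2E)
  have s0: "s \<noteq> 0" using st(1) by (simp add: reg_pair_def)
  define p q where "p = v * \<alpha> - \<beta> * u" and "q = v * \<gamma> - \<delta> * u"
  have vg: "v * g = - u * f" using uv by (simp add: eq_neg_iff_add_eq_0 add.commute)
  have vs: "v * s = p * f"
  proof -
    have "v * s = v * \<alpha> * f + \<beta> * (v * g)" unfolding s by (simp add: algebra_simps)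
    then show ?thesis unfolding vg p_def by (simp add: algebra_simps)
  qed
  have vt: "v * t = q * f"
  proof -
    have "v * t = v * \<gamma> * f + \<delta> * (v * g)" unfolding t by (simp add: algebra_simps)
    then show ?thesis unfolding vg q_def by (simp add: algebra_simps)
  qed
  have "(q * s) * f = (q * f) * s" by (simp add: algebra_simps)
  also have "\<dots> = (v * s) * t" unfolding vt[symmetric] by (simp add: algebra_simps)
  also have "\<dots> = (p * t) * f" unfolding vs by (simp add: algebra_simps)
  finally have "(q * s) * f = (p * t) * f" .
  then have "q * s = p * t" using f by simp
  then have "s dvd p" by (rule reg_pairD[OF st(1)])
  then obtain w where w: "p = s * w" by (elim dvdE)
  have "s * v = s * (w * f)" using vs w by (simp add: algebra_simps)
  then have v: "v = w * f" using s0 by simp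
  have "f * u = f * (- (w * g))" using vg unfolding v by (simp add: algebra_simps)
  then have "u = - (w * g)" using mult_left_cancel[OF f] by blast
  with v show thesis by (rule that)
qed

text \<open>Excludes principal ideals: the identity
  \<open>\<delta> * (\<beta> * g) = \<beta> * (\<delta> * g)\<close> and regularity force
  \<open>\<beta> * g\<close> to divide \<open>\<beta>\<close>.\<close>

lemma reg_pair_multiples:
  fixes g :: "'a::idom"
  assumes "reg_pair (\<beta> * g) (\<delta> * g)"
  shows "g dvd 1"
proof -
  have "\<beta> * g dvd \<beta>" using reg_pairD[OF assms, of \<delta> \<beta>] by (simp add: algebra_simps)
  then obtain k where "\<beta> = \<beta> * g * k" by (elim dvdE)
  then have "\<beta> * (g * k) = \<beta> * 1" by (simp add: algebra_simps)
  moreover have "\<beta> \<noteq> 0" using assms unfolding reg_pair_def by auto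
  ultimately have "g * k = 1" using mult_left_cancel by blast
  then show ?thesis by (intro dvdI[of _ _ k]) simp
qed

text \<open>
  An elementary form of \<open>((f, g) : N) / (f, g) \<cong> Ext\<^sup>2 (R / N, R) \<cong> ((s1, s2) : N) / (s1, s2)\<close> for
  \<open>N = (s1, s2, s3)\<close>; the last quotient vanishes because \<open>s3\<close> is regular modulo \<open>(s1, s2)\<close>.
\<close>

lemma reg_seq_annihilator:
  fixes f g x :: "'a::idom"
  assumes st: "reg_pair s t" "s \<in> ideal2 f g" "t \<in> ideal2 f g"
    and r12: "reg_pair s1 s2"
    and r3: "\<And>w. s3 * w \<in> ideal2 s1 s2 \<Longrightarrow> w \<in> ideal2 s1 s2"
    and x: "s1 * x \<in> ideal2 f g" "s2 * x \<in> ideal2 f g" "s3 * x \<in> ideal2 f g"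
  shows "x \<in> ideal2 f g"
proof (cases "f = 0")
  case True
  obtain \<alpha> \<beta> where "s = \<alpha> * f + \<beta> * g" using st(2) by (rule ideal2E)
  then have "s = \<beta> * g" using True by simp
  moreover obtain \<gamma> \<delta> where "t = \<gamma> * f + \<delta> * g" using st(3) by (rule ideal2E)
  then have "t = \<delta> * g" using True by simp
  ultimately have "g dvd 1" using st(1) reg_pair_multiples by metis
  then have "g dvd x" using dvd_trans one_dvd by blast
  then obtain k where "x = g * k" by (elim dvdE)
  then show ?thesis by (intro ideal2I[of _ 0 _ k]) (simp add: mult.commute)
next
  case f: False
  obtain u1 v1 where e1: "s1 * x = u1 * f + v1 * g" using x(1) by (rule ideal2E)
  obtain u2 v2 where e2: "s2 * x = u2 * f + v2 * g" using x(2) by (rule ideal2E)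
  obtain u3 v3 where e3: "s3 * x = u3 * f + v3 * g" using x(3) by (rule ideal2E)
  \<comment> \<open>Two expressions for \<open>s1 * s2 * x\<close> differ by a relation between
    \<open>f\<close> and \<open>g\<close>, which is a Koszul multiple \<open>w12\<close>; likewise
    \<open>w13\<close> and \<open>w23\<close> for the other pairs.\<close>
  have "(s2 * u1 - s1 * u2) * f + (s2 * v1 - s1 * v2) * g = s2 * (u1 * f + v1 * g) - s1 * (u2 * f + v2 * g)"
    by (simp add: algebra_simps)
  also have "\<dots> = 0" by (simp flip: e1 e2)
  finally obtain w12 where w12: "s2 * v1 - s1 * v2 = w12 * f" "s2 * u1 - s1 * u2 = - (w12 * g)"
    by (rule reg_pair_syzygy[OF st f])
  have "(s3 * u1 - s1 * u3) * f + (s3 * v1 - s1 * v3) * g = s3 * (u1 * f + v1 * g) - s1 * (u3 * f + v3 * g)"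
    by (simp add: algebra_simps)
  also have "\<dots> = 0" by (simp flip: e1 e3)
  finally obtain w13 where w13: "s3 * v1 - s1 * v3 = w13 * f"
    by (rule reg_pair_syzygy[OF st f])
  have "(s3 * u2 - s2 * u3) * f + (s3 * v2 - s2 * v3) * g = s3 * (u2 * f + v2 * g) - s2 * (u3 * f + v3 * g)"
    by (simp add: algebra_simps)
  also have "\<dots> = 0" by (simp flip: e2 e3)
  finally obtain w23 where w23: "s3 * v2 - s2 * v3 = w23 * f"
    by (rule reg_pair_syzygy[OF st f])
  \<comment> \<open>The three multiples satisfy the cocycle identity
    \<open>s3 * w12 = s2 * w13 - s1 * w23\<close>, so regularity of \<open>s3\<close> applies to
    \<open>w12\<close>.\<close>
  have "(s3 * w12) * f = s2 * (w13 * f) - s1 * (w23 * f)"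
    unfolding mult.assoc w12(1)[symmetric] w13[symmetric] w23[symmetric] by (simp add: algebra_simps)
  also have "\<dots> = (- w23 * s1 + w13 * s2) * f" by (simp add: algebra_simps)
  finally have "s3 * w12 = - w23 * s1 + w13 * s2" using f by simp
  then have "w12 \<in> ideal2 s1 s2" by (rule r3[OF ideal2I])
  then obtain q p where pq: "w12 = q * s1 + p * s2" by (rule ideal2E)
  \<comment> \<open>With \<open>w12 = q * s1 + p * s2\<close>, changing the coefficients of
    \<open>s1 * x\<close> by the Koszul relation with factor \<open>p\<close> makes both divisible
    by \<open>s1\<close>, which then cancels.\<close>
  have "(v2 + q * f) * s1 = (v1 - p * f) * s2" using w12(1) unfolding pq by (simp add: algebra_simps)
  then have "s1 dvd v1 - p * f" by (rule reg_pairD[OF r12])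
  then obtain r' where r': "v1 - p * f = s1 * r'" by (elim dvdE)
  have "(u2 - q * g) * s1 = (u1 + p * g) * s2" using w12(2) unfolding pq by (simp add: algebra_simps)
  then have "s1 dvd u1 + p * g" by (rule reg_pairD[OF r12])
  then obtain r where r: "u1 + p * g = s1 * r" by (elim dvdE)
  have "s1 * x = (u1 + p * g) * f + (v1 - p * f) * g" unfolding e1 by (simp add: algebra_simps)
  also have "\<dots> = s1 * (r * f + r' * g)" unfolding r r' by (simp add: algebra_simps)
  finally have "x = r * f + r' * g" using r12 unfolding reg_pair_def by simp
  then show ?thesis by (rule ideal2I)
qed

text \<open>A monic polynomial is not a zero divisor modulo \<open>I[X]\<close>: if \<open>m\<close>
  is the largest index at which \<open>y\<close> has a coefficient outside \<open>I\<close>, the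
  coefficient of \<open>h * y\<close> at \<open>degree h + m\<close> is that coefficient modulo
  \<open>I\<close>.\<close>

lemma coeffs_in_ideal_of_monic_mult:
  fixes h y :: "'a::comm_ring_1 poly"
  assumes I: "is_ideal I" and h: "lead_coeff h = 1" and hy: "\<And>i. coeff (h * y) i \<in> I"
  shows "coeff y i \<in> I"
proof (rule ccontr)
  assume ni: "coeff y i \<notin> I"
  define B where "B = {j. coeff y j \<notin> I}"
  have "B \<subseteq> {..degree y}"
    unfolding B_def using is_ideal_0[OF I] by (auto intro: le_degree)
  then have fB: "finite B" by (rule finite_subset) simp
  define m where "m = Max B"
  have mB: "m \<in> B" unfolding m_def using fB ni by (intro Max_in) (auto simp: B_def)
  have big: "coeff y j \<in> I" if "j > m" for j
    using Max_ge[OF fB, of j] that unfolding m_def B_def by auto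
  have "coeff (h * y) (degree h + m) = (\<Sum>k\<le>degree h + m. coeff h k * coeff y (degree h + m - k))"
    by (rule coeff_mult)
  also have "\<dots> = coeff h (degree h) * coeff y (degree h + m - degree h)
      + (\<Sum>k\<in>{..degree h + m} - {degree h}. coeff h k * coeff y (degree h + m - k))"
    by (rule sum.remove) auto
  finally have "coeff y m = coeff (h * y) (degree h + m)
      - (\<Sum>k\<in>{..degree h + m} - {degree h}. coeff h k * coeff y (degree h + m - k))"
    using h by simp
  also have "\<dots> \<in> I"
  proof (intro is_ideal_diff[OF I] is_ideal_sum[OF I] hy)
    fix k assume "k \<in> {..degree h + m} - {degree h}"
    then consider "k < degree h" | "k > degree h" by fastforce
    then show "coeff h k * coeff y (degree h + m - k) \<in> I"
    proof cases
      case 1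
      then show ?thesis by (intro is_ideal_mult[OF I] big) simp
    next
      case 2
      then show ?thesis by (simp add: coeff_eq_0 is_ideal_0[OF I])
    qed
  qed
  finally show False using mB unfolding B_def by blast
qed

lemma const_poly_ideal2_iff:
  fixes p :: "'a::comm_ring_1 poly"
  shows "p \<in> ideal2 [:a:] [:b:] \<longleftrightarrow> (\<forall>i. coeff p i \<in> ideal2 a b)"
proof
  assume "p \<in> ideal2 [:a:] [:b:]"
  then obtain u v where "p = u * [:a:] + v * [:b:]" by (rule ideal2E)
  then show "\<forall>i. coeff p i \<in> ideal2 a b"
    by (auto intro!: ideal2I[of _ "coeff u _" _ "coeff v _"] simp: mult.commute)
next
  show "\<forall>i. coeff p i \<in> ideal2 a b \<Longrightarrow> p \<in> ideal2 [:a:] [:b:]"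
  proof (induction p)
    case 0
    show ?case by (rule is_ideal_0[OF is_ideal_ideal2])
  next
    case (pCons c p)
    have "\<forall>i. coeff p i \<in> ideal2 a b" "c \<in> ideal2 a b"
      using pCons.prems[rule_format, of "Suc _"] pCons.prems[rule_format, of 0] by simp_all
    then have "p \<in> ideal2 [:a:] [:b:]" "c \<in> ideal2 a b" using pCons.IH by blast+
    then obtain U V u v where "p = U * [:a:] + V * [:b:]" "c = u * a + v * b"
      by (meson ideal2E)
    then have "pCons c p = pCons u U * [:a:] + pCons v V * [:b:]" by (simp add: mult.commute)
    then show ?case by (rule ideal2I)
  qed
qed

text \<open>The constants \<open>p\<close>, \<open>c\<close> and the monic \<open>h\<close> supply
  the regular sequence of length three in \<open>R[X]\<close>.\<close>

lemma poly_reg_seq_annihilator: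
  fixes f g x :: "'a::{comm_ring_1, idom} poly"
  assumes st: "reg_pair s t" "s \<in> ideal2 f g" "t \<in> ideal2 f g"
    and p: "prime_elem p" "\<not> p dvd c" and h: "lead_coeff h = 1"
    and x: "[:p:] * x \<in> ideal2 f g" "[:c:] * x \<in> ideal2 f g" "h * x \<in> ideal2 f g"
  shows "x \<in> ideal2 f g"
proof (rule reg_seq_annihilator[OF st _ _ x])
  have "prime_elem [:p:]" using p(1) by (rule lift_prime_elem_poly)
  from prime_elem_imp_reg_pair[OF this, of "[:c:]" 1 1] p(2) show "reg_pair [:p:] [:c:]" by simp
  fix w assume "h * w \<in> ideal2 [:p:] [:c:]"
  then show "w \<in> ideal2 [:p:] [:c:]"
    using coeffs_in_ideal_of_monic_mult[OF is_ideal_ideal2 h] unfolding const_poly_ideal2_iff by blast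
qed

section \<open>Consequences of radical finiteness\<close>

text \<open>Finite chains give the descending chain condition between \<open>A\<close> and
  \<open>P\<close>. For an ideal \<open>J\<close> minimal above \<open>A\<close> the quotient
  \<open>J / A\<close> is simple, so the annihilator modulo \<open>A\<close> of any \<open>x\<close>
  in \<open>J\<close> outside \<open>A\<close> is maximal. The conclusion states this by inverses
  modulo the annihilator.\<close>

lemma ex_maximal_annihilator:
  fixes A P :: "'a::comm_ring_1 set"
  assumes A: "is_ideal A" and P: "is_ideal P" and AP: "A \<subseteq> P" "A \<noteq> P"
    and ch: "\<And>C. (\<And>J. J \<in> C \<Longrightarrow> is_ideal J \<and> A \<subseteq> J \<and> J \<subseteq> P) \<Longrightarrow>
      (\<And>J1 J2. J1 \<in> C \<Longrightarrow> J2 \<in> C \<Longrightarrow> J1 \<subseteq> J2 \<or> J2 \<subseteq> J1) \<Longrightarrow> finite C"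
  shows "\<exists>x\<in>P - A. \<forall>y. y * x \<notin> A \<longrightarrow> (\<exists>r. (1 - r * y) * x \<in> A)"
proof -
  define R where "R = {(J, K). is_ideal J \<and> A \<subset> J \<and> J \<subset> K \<and> K \<subseteq> P}"
  have "wf R"
    unfolding wf_iff_no_infinite_down_chain
  proof
    assume "\<exists>F. \<forall>i. (F (Suc i), F i) \<in> R"
    then obtain F where F: "\<And>i. (F (Suc i), F i) \<in> R" by blast
    \<comment> \<open>The shift discards \<open>F 0\<close>, about which membership in
      \<open>R\<close> says only that it lies inside \<open>P\<close>.\<close>
    define G where "G i = F (Suc i)" for i
    have G: "is_ideal (G i)" "A \<subseteq> G i" "G i \<subseteq> P" "G (Suc i) \<subset> G i" for i
      using F[of i] F[of "Suc i"] unfolding R_def G_def by auto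
    have anti: "G j \<subset> G i" if "i < j" for i j
      using that by (induction j) (use G(4) in \<open>auto simp: less_Suc_eq\<close>)
    have "finite (range G)"
    proof (rule ch)
      show "is_ideal J \<and> A \<subseteq> J \<and> J \<subseteq> P" if "J \<in> range G" for J
        using that G by blast
      show "J1 \<subseteq> J2 \<or> J2 \<subseteq> J1" if "J1 \<in> range G" "J2 \<in> range G" for J1 J2
      proof -
        obtain i j where "J1 = G i" "J2 = G j" using \<open>J1 \<in> range G\<close> \<open>J2 \<in> range G\<close> by blast
        then show ?thesis using anti[of i j] anti[of j i] by (cases i j rule: linorder_cases) auto
      qed
    qed
    moreover have "inj G"
    proof (rule injI)
      fix i j assume "G i = G j"
      then show "i = j" using anti[of i j] anti[of j i] by (cases i j rule: linorder_cases) auto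
    qed
    ultimately show False using finite_imageD infinite_UNIV_nat by blast
  qed
  moreover have "P \<in> {J. is_ideal J \<and> A \<subset> J \<and> J \<subseteq> P}" using P AP by blast
  ultimately obtain J where J: "is_ideal J" "A \<subset> J" "J \<subseteq> P"
    and min: "\<And>K. (K, J) \<in> R \<Longrightarrow> \<not> (is_ideal K \<and> A \<subset> K \<and> K \<subseteq> P)"
    by (rule wfE_min) blast
  then obtain x where x: "x \<in> J" "x \<notin> A" by blast
  have "\<exists>r. (1 - r * y) * x \<in> A" if y: "y * x \<notin> A" for y
  proof -
    \<comment> \<open>\<open>K\<close> is generated by \<open>A\<close> and \<open>y * x\<close>;
      minimality gives \<open>K = J\<close>, so \<open>x\<close> lies in it.\<close>
    define K where "K = {z. \<exists>r. z - r * (y * x) \<in> A}"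
    have K: "is_ideal K"
      unfolding K_def by (rule is_ideal_adjoin[OF A])
    have "A \<subseteq> K" unfolding K_def by (auto intro!: exI[of _ 0])
    moreover have "y * x \<in> K" unfolding K_def using is_ideal_0[OF A] by (auto intro!: exI[of _ 1])
    ultimately have AK: "A \<subset> K" using y by blast
    have KJ: "K \<subseteq> J"
    proof
      fix z assume "z \<in> K"
      then obtain r where "z - r * (y * x) \<in> A" unfolding K_def by blast
      then have "(z - r * (y * x)) + r * y * x \<in> J"
        using J x by (intro is_ideal_add[OF J(1)] is_ideal_mult[OF J(1)]) auto
      then show "z \<in> J" by (simp add: mult.assoc)
    qed
    have "K = J"
      using min[of K] K AK KJ J(3) unfolding R_def by auto
    then obtain r where "x - r * (y * x) \<in> A" using x(1) unfolding K_def by blast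
    then show ?thesis by (intro exI[of _ r]) (simp add: algebra_simps)
  qed
  then show ?thesis using x J(3) by blast
qed

text \<open>Radical perfectness bounds the height of \<open>Q\<close> by 3. Any chain of primes
  ending in \<open>P\<close> can be prolonged by a prime above \<open>Q\<close>, which costs one
  unit of height.\<close>

lemma ht_le_2_of_psubset:
  fixes P Q :: "'a::comm_ring_1 set"
  assumes rp: "radically_perfect Q" and P: "prime_ideal P" and PQ: "P \<subset> Q"
    and gen: "rad Q = rad (gen_by 3 \<theta>)"
  shows "ht P \<le> 2"
proof -
  have "ht Q = (INF n \<in> {n. \<exists>\<theta>. rad Q = rad (gen_by n \<theta>)}. enat n)"
    using rp unfolding radically_perfect_def by blast
  also have "\<dots> \<le> enat 3" using gen by (intro INF_lower) blast
  \<comment> \<open>The strict bound 4 is what produces a witness \<open>Q'\<close> for the infimum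
    defining \<open>ht\<close>.\<close>
  also have "\<dots> < enat 4" by simp
  finally obtain Q' where Q': "prime_ideal Q'" "Q \<subseteq> Q'" "prime_height Q' < enat 4"
    unfolding ht_def INF_less_iff by blast
  have "ht P \<le> prime_height P" unfolding ht_def using P by (intro INF_lower) blast
  also have "prime_height P \<le> enat 2"
    unfolding prime_height_def
  proof (rule Sup_least)
    fix m assume "m \<in> {enat n | n. \<exists>f :: nat \<Rightarrow> 'a set.
      (\<forall>i\<le>n. prime_ideal (f i)) \<and> (\<forall>i<n. f i \<subset> f (Suc i)) \<and> f n = P}"
    then obtain n f where f: "m = enat n" "\<And>i. i \<le> n \<Longrightarrow> prime_ideal (f i)"
      "\<And>i. i < n \<Longrightarrow> f i \<subset> f (Suc i)" "f n = P" by blast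
    define f' where "f' i = (if i \<le> n then f i else Q')" for i
    have 1: "prime_ideal (f' i)" if "i \<le> Suc n" for i
      using that f Q' unfolding f'_def by simp
    have 2: "f' i \<subset> f' (Suc i)" if "i < Suc n" for i
    proof (cases "i < n")
      case True
      then show ?thesis using f(3) unfolding f'_def by simp
    next
      case False
      then have "i = n" using that by simp
      then show ?thesis using f(4) PQ Q'(2) unfolding f'_def by auto
    qed
    have "f' (Suc n) = Q'" unfolding f'_def by simp
    with 1 2 have "enat (Suc n) \<le> prime_height Q'"
      unfolding prime_height_def by (intro Sup_upper) blast
    then have "enat (Suc n) < enat 4" using Q'(3) by (rule order_le_less_trans)
    then show "m \<le> enat 2" unfolding f(1) by simp
  qed
  finally show ?thesis by (simp add: numeral_eq_enat)
qed

text \<open>Radical finiteness gives \<open>A = (f, g)\<close> with radical \<open>P\<close> and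
  finite chains up to \<open>P\<close>. If \<open>A \<noteq> P\<close>, some \<open>x\<close> in
  \<open>P\<close> outside \<open>A\<close> has a maximal annihilator \<open>N\<close> modulo
  \<open>A\<close>. Hypothesis \<open>N\<close> puts a regular sequence of length three into it,
  while powers of \<open>s\<close> and \<open>t\<close> give a regular pair in \<open>A\<close>, so
  \<open>x\<close> would lie in \<open>A\<close>.\<close>

lemma radically_finite_two_generated:
  fixes P :: "'a::{comm_ring_1, idom} poly set"
  assumes rf: "radically_finite TYPE('a poly)" and P: "prime_ideal P" and ht: "ht P \<le> 2"
    and st: "s \<in> P" "t \<in> P" "\<And>k l. reg_pair (s ^ k) (t ^ l)"
    and N: "\<And>N. is_ideal N \<Longrightarrow> P \<subseteq> N \<Longrightarrow> 1 \<notin> N \<Longrightarrow> (\<And>y. y \<notin> N \<Longrightarrow> \<exists>r. 1 - r * y \<in> N) \<Longrightarrow>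
      \<exists>p c h. prime_elem p \<and> \<not> p dvd c \<and> lead_coeff h = 1 \<and> [:p:] \<in> N \<and> [:c:] \<in> N \<and> h \<in> N"
  obtains f g where "P = ideal2 f g"
proof -
  have "\<exists>A\<in>{J. \<exists>n \<theta>. ht P = enat n \<and> J = gen_by n \<theta> \<and> rad J = P}.
      \<forall>C. (\<forall>J\<in>C. is_ideal J \<and> A \<subseteq> J \<and> J \<subseteq> P) \<and> (\<forall>J1\<in>C. \<forall>J2\<in>C. J1 \<subseteq> J2 \<or> J2 \<subseteq> J1) \<longrightarrow> finite C"
    using rf[unfolded radically_finite_def Let_def, rule_format, OF P, THEN conjunct2]
    by (elim bexE conjE) (rule bexI)
  then obtain A where A': "\<exists>n \<theta>. ht P = enat n \<and> A = gen_by n \<theta> \<and> rad A = P"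
    and ch: "\<forall>C. (\<forall>J\<in>C. is_ideal J \<and> A \<subseteq> J \<and> J \<subseteq> P) \<and> (\<forall>J1\<in>C. \<forall>J2\<in>C. J1 \<subseteq> J2 \<or> J2 \<subseteq> J1) \<longrightarrow> finite C"
    by (elim bexE CollectE)
  from A' obtain n \<theta> where A: "ht P = enat n" "A = gen_by n \<theta>" "rad A = P"
    by (elim exE conjE)
  have "n \<le> 2" using ht A(1) by (simp add: numeral_eq_enat)
  then obtain f g where fg: "A = ideal2 f g" unfolding A(2) by (rule gen_by_le_2)
  have Ai: "is_ideal A" unfolding fg by (rule is_ideal_ideal2)
  have AP: "A \<subseteq> P" unfolding A(3)[symmetric] rad_def by (auto intro: exI[of _ 1])
  have "A = P"
  proof (rule ccontr)
    assume ne: "A \<noteq> P"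
    have fin: "finite C" if "\<And>J. J \<in> C \<Longrightarrow> is_ideal J \<and> A \<subseteq> J \<and> J \<subseteq> P"
        "\<And>J1 J2. J1 \<in> C \<Longrightarrow> J2 \<in> C \<Longrightarrow> J1 \<subseteq> J2 \<or> J2 \<subseteq> J1" for C
      using ch[THEN spec, of C, THEN mp] that by simp
    obtain x where x: "x \<in> P" "x \<notin> A" "\<And>y. y * x \<notin> A \<Longrightarrow> \<exists>r. (1 - r * y) * x \<in> A"
      using ex_maximal_annihilator[OF Ai prime_idealD(1)[OF P] AP ne fin] by blast
    define N where "N = {y. y * x \<in> A}"
    have Ni: "is_ideal N"
      unfolding N_def is_ideal_def
      using is_ideal_0[OF Ai] is_ideal_add[OF Ai] is_ideal_mult[OF Ai] by (auto simp: distrib_right mult.assoc)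
    have N1: "1 \<notin> N" unfolding N_def using x(2) by simp
    have Nmax: "\<exists>r. 1 - r * y \<in> N" if "y \<notin> N" for y
      using x(3)[of y] that unfolding N_def by blast
    have AN: "A \<subseteq> N" unfolding N_def using is_ideal_mult2[OF Ai] by blast
    \<comment> \<open>A maximal ideal containing \<open>A\<close> contains the radical of
      \<open>A\<close>; the induction lowers the exponent until \<open>1\<close> is reached.\<close>
    have "P \<subseteq> N"
    proof
      fix y assume "y \<in> P"
      then obtain k where "y ^ k \<in> A" unfolding A(3)[symmetric] rad_def by blast
      then have k: "y ^ k \<in> N" using AN by blast
      show "y \<in> N"
      proof (rule ccontr)
        assume "y \<notin> N"
        then obtain r where r: "1 - r * y \<in> N" using Nmax by blast
        have "1 \<in> N"
          using k
        proof (induction k)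
          case 0
          then show ?case by simp
        next
          case (Suc k)
          have "y ^ k * (1 - r * y) + r * y ^ Suc k \<in> N"
            by (intro is_ideal_add[OF Ni] is_ideal_mult[OF Ni] r Suc.prems)
          then have "y ^ k \<in> N" by (simp add: algebra_simps)
          then show ?case by (rule Suc.IH)
        qed
        then show False using N1 by blast
      qed
    qed
    from N[OF Ni this N1 Nmax] obtain p c h where pch: "prime_elem p" "\<not> p dvd c" "lead_coeff h = 1"
      "[:p:] \<in> N" "[:c:] \<in> N" "h \<in> N" by blast
    obtain k l where kl: "s ^ k \<in> A" "t ^ l \<in> A"
      using st(1,2) unfolding A(3)[symmetric] rad_def by blast
    have "x \<in> A"
      using poly_reg_seq_annihilator[OF st(3)[of k l], of f g p c h x] kl pch
      unfolding N_def fg by blast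
    then show False using x(2) by blast
  qed
  then show thesis using that fg by blast
qed

section \<open>Maximal ideals generated by a regular pair\<close>

text \<open>\<open>M_max\<close> expresses maximality by inverses modulo \<open>M\<close>, and
  \<open>syzygy\<close> says that \<open>a\<close> and \<open>b\<close> have only Koszul relations.
  Together they allow coefficients of low-degree monomials in \<open>a\<close> and \<open>b\<close>
  to be compared modulo \<open>M\<close>.\<close>

locale regular_maximal_ideal =
  fixes M :: "'a::idom set" and a b :: 'a
  assumes M_eq: "M = ideal2 a b"
    and one_notin_M: "1 \<notin> M"
    and M_max: "\<And>y. y \<notin> M \<Longrightarrow> \<exists>r. 1 - r * y \<in> M"
    and syzygy: "\<And>u v. u * a + v * b = 0 \<Longrightarrow> \<exists>w. v = w * a \<and> u = - (w * b)"
begin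

lemma M_ideal: "is_ideal M"
  unfolding M_eq by (rule is_ideal_ideal2)

lemma a_in_M: "a \<in> M" and b_in_M: "b \<in> M"
  unfolding M_eq by (rule ideal2_gens)+

lemma M_prime: "x * y \<in> M \<Longrightarrow> x \<in> M \<or> y \<in> M"
proof (rule ccontr)
  assume xy: "x * y \<in> M" and "\<not> (x \<in> M \<or> y \<in> M)"
  then obtain r where "1 - r * x \<in> M" using M_max by blast
  then have "(1 - r * x) * y + r * (x * y) \<in> M"
    using xy by (intro is_ideal_add[OF M_ideal] is_ideal_mult[OF M_ideal xy] is_ideal_mult2[OF M_ideal])
  then have "y \<in> M" by (simp add: algebra_simps)
  then show False using \<open>\<not> (x \<in> M \<or> y \<in> M)\<close> by blast
qed

lemma M_cancel: "x + y \<in> M \<Longrightarrow> x \<in> M \<Longrightarrow> y \<in> M"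
  using is_ideal_diff[OF M_ideal, of "x + y" x] by simp

lemma M_cancel2: "x + y \<in> M \<Longrightarrow> y \<in> M \<Longrightarrow> x \<in> M"
  using is_ideal_diff[OF M_ideal, of "x + y" y] by simp

lemma one_plus_notin_M: "x \<in> M \<Longrightarrow> x + 1 \<notin> M"
  using M_cancel[of x 1] one_notin_M by blast

lemma dvd_b_imp_in_M: "b dvd x \<Longrightarrow> x \<in> M"
  using is_ideal_mult2[OF M_ideal b_in_M] by (auto elim!: dvdE)

lemma syzygy_a_power: "u * a ^ n + v * b = 0 \<Longrightarrow> \<exists>w. v = w * a ^ n \<and> u = - (w * b)"
proof (induction n arbitrary: u v)
  case 0
  then show ?case by (intro exI[of _ v]) (simp add: eq_neg_iff_add_eq_0)
next
  case (Suc n)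
  then have "(u * a) * a ^ n + v * b = 0" by (simp add: mult.assoc)
  from Suc.IH[OF this] obtain w where w: "v = w * a ^ n" "u * a = - (w * b)" by blast
  then have "u * a + w * b = 0" by simp
  then obtain w' where "w = w' * a" "u = - (w' * b)" using syzygy by blast
  then show ?case using w by (intro exI[of _ w']) (simp add: mult.assoc)
qed

text \<open>The relations between \<open>a ^ 2\<close>, \<open>a * b\<close>, \<open>b ^ 2\<close>
  are spanned by \<open>(b, - a, 0)\<close> and \<open>(0, - b, a)\<close>, with coefficients
  \<open>x'\<close> and \<open>z'\<close>.\<close>

lemma quadratic_relation:
  assumes "x * a ^ 2 + y * (a * b) + z * b ^ 2 = 0"
  obtains x' z' where "x = b * x'" "z = a * z'" "y = - (a * x') - b * z'"
proof -
  have "(x * a + y * b) * a + (z * b) * b = 0"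
    using assms by (simp add: algebra_simps power2_eq_square)
  then obtain w where w: "z * b = w * a" "x * a + y * b = - (w * b)" using syzygy by blast
  have "(- w) * a + z * b = 0" using w(1) by simp
  then obtain w2 where w2: "z = w2 * a" "- w = - (w2 * b)" using syzygy by blast
  have "x * a + (y + w) * b = (x * a + y * b) + w * b" by (simp add: algebra_simps)
  then have "x * a + (y + w) * b = 0" unfolding w(2) by simp
  then obtain w' where w': "y + w = w' * a" "x = - (w' * b)" using syzygy by blast
  show thesis
    by (rule that[of "- w'" w2]) (use w2 w' in \<open>simp_all add: algebra_simps eq_diff_eq\<close>)
qed

text \<open>Using \<open>syzygy\<close> three times gives \<open>t = w2 * a\<close>, so
  \<open>t * b ^ 3\<close> moves into the \<open>a * b ^ 2\<close> term; a factor \<open>a\<close>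
  then cancels and a quadratic relation remains.\<close>

lemma cubic_relation:
  assumes "x * a ^ 3 + y * (a ^ 2 * b) + z * (a * b ^ 2) + t * b ^ 3 = 0"
  shows "b dvd x" "y \<in> M" "z \<in> M" "t \<in> M"
proof -
  have "(x * a ^ 2 + y * (a * b) + z * b ^ 2) * a + (t * b ^ 2) * b = 0"
    using assms by (simp add: algebra_simps power2_eq_square power3_eq_cube)
  then obtain w where w: "t * b ^ 2 = w * a" "x * a ^ 2 + y * (a * b) + z * b ^ 2 = - (w * b)"
    using syzygy by blast
  have "(- w) * a + (t * b) * b = 0" using w(1) by (simp add: algebra_simps power2_eq_square)
  then obtain w1 where w1: "t * b = w1 * a" "w = w1 * b" using syzygy by fastforce
  have "(- w1) * a + t * b = 0" using w1(1) by simp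
  then obtain w2 where w2: "t = w2 * a" "w1 = w2 * b" using syzygy by fastforce
  have "x * a ^ 2 + y * (a * b) + (z + w2 * b) * b ^ 2
      = (x * a ^ 2 + y * (a * b) + z * b ^ 2) + w * b"
    unfolding w1(2) w2(2) by (simp add: algebra_simps power2_eq_square)
  then have "x * a ^ 2 + y * (a * b) + (z + w2 * b) * b ^ 2 = 0" unfolding w(2) by simp
  then obtain x' z' where xz: "x = b * x'" "z + w2 * b = a * z'" "y = - (a * x') - b * z'"
    by (rule quadratic_relation)
  show "b dvd x" using xz(1) by simp
  show "y \<in> M" unfolding xz(3)
    by (intro is_ideal_diff[OF M_ideal] is_ideal_uminus[OF M_ideal] is_ideal_mult2[OF M_ideal] a_in_M b_in_M)
  have "z + w2 * b \<in> M" unfolding xz(2) by (intro is_ideal_mult2[OF M_ideal] a_in_M)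
  moreover have "w2 * b \<in> M" by (intro is_ideal_mult[OF M_ideal] b_in_M)
  ultimately show "z \<in> M" by (rule M_cancel2)
  show "t \<in> M" unfolding w2(1) by (intro is_ideal_mult[OF M_ideal] a_in_M)
qed

lemma M_elem:
  assumes "x \<in> M" obtains u v where "x = u * a + v * b"
  using assms unfolding M_eq by (rule ideal2E)

text \<open>Coefficients are compared first in degree two, then in degree three, where the
  right-hand side starts with \<open>- b ^ 3\<close>. The case distinctions record which
  coefficients are invertible modulo \<open>M\<close>.\<close>

lemma cusp_no_factor_aux:
  assumes eq: "(r1 * a + s1 * b) * (r2 * a + s2 * b) = a ^ 4 - b ^ 3" and s1: "s1 \<in> M"
  shows False
proof -
  \<comment> \<open>Writing \<open>a ^ 4 = a ^ 2 * a ^ 2\<close> and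
    \<open>b ^ 3 = b * b ^ 2\<close> turns the factorization into a single quadratic
    relation.\<close>
  have "(r1 * r2 - a ^ 2) * a ^ 2 + (r1 * s2 + r2 * s1) * (a * b) + (s1 * s2 + b) * b ^ 2 = 0"
    using eq by (simp add: algebra_simps power2_eq_square power3_eq_cube power4_eq_xxxx)
  then obtain x' z' where q: "r1 * r2 - a ^ 2 = b * x'" "s1 * s2 + b = a * z'"
      "r1 * s2 + r2 * s1 = - (a * x') - b * z'"
    by (rule quadratic_relation)
  obtain \<sigma>' \<tau> where s1_eq: "s1 = \<sigma>' * a + \<tau> * b" using s1 by (rule M_elem)
  show False
  proof (cases "s2 \<in> M")
    case True
    have "(\<sigma>' * s2 - z') * a + (\<tau> * s2 + 1) * b = 0"
      using q(2) unfolding s1_eq by (simp add: algebra_simps)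
    then obtain w where "\<tau> * s2 + 1 = w * a" using syzygy by blast
    then have "\<tau> * s2 + 1 \<in> M" using is_ideal_mult[OF M_ideal a_in_M] by metis
    moreover have "\<tau> * s2 \<in> M" using True by (rule is_ideal_mult[OF M_ideal])
    ultimately show False using one_plus_notin_M by blast
  next
    case s2: False
    have "r1 * s2 + r2 * s1 \<in> M" unfolding q(3)
      by (intro is_ideal_diff[OF M_ideal] is_ideal_uminus[OF M_ideal] is_ideal_mult2[OF M_ideal] a_in_M b_in_M)
    moreover have "r2 * s1 \<in> M" using s1 by (rule is_ideal_mult[OF M_ideal])
    ultimately have "r1 * s2 \<in> M" by (rule M_cancel2)
    then have "r1 \<in> M" using s2 M_prime by blast
    then obtain \<rho> \<mu> where r1_eq: "r1 = \<rho> * a + \<mu> * b" by (rule M_elem)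
    \<comment> \<open>Now the first factor is
      \<open>\<rho> * a ^ 2 + \<sigma> * (a * b) + \<tau> * b ^ 2\<close>, so the equation becomes a
      cubic relation.\<close>
    define \<sigma> where "\<sigma> = \<mu> + \<sigma>'"
    have "(\<rho> * r2 - a) * a ^ 3 + (\<rho> * s2 + \<sigma> * r2) * (a ^ 2 * b)
        + (\<sigma> * s2 + \<tau> * r2) * (a * b ^ 2) + (\<tau> * s2 + 1) * b ^ 3 = 0"
      using eq unfolding r1_eq s1_eq \<sigma>_def
      by (simp add: algebra_simps power2_eq_square power3_eq_cube power4_eq_xxxx)
    note c = cubic_relation[OF this]
    show False
    proof (cases "r2 \<in> M")
      case True
      have "\<rho> * s2 \<in> M" using c(2) is_ideal_mult[OF M_ideal True] by (rule M_cancel2)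
      then have "\<rho> \<in> M" using s2 M_prime by blast
      then obtain \<rho>1 \<rho>2 where \<rho>: "\<rho> = \<rho>1 * a + \<rho>2 * b" by (rule M_elem)
      obtain x where x: "\<rho> * r2 - a = b * x" using c(1) by (elim dvdE)
      have "(\<rho>1 * r2 - 1) * a + (\<rho>2 * r2 - x) * b = 0"
        using x unfolding \<rho> by (simp add: algebra_simps)
      then obtain w where "\<rho>1 * r2 - 1 = - (w * b)" using syzygy by blast
      then have 1: "\<rho>1 * r2 - 1 \<in> M"
        using is_ideal_uminus[OF M_ideal is_ideal_mult[OF M_ideal b_in_M]] by metis
      have 2: "\<rho>1 * r2 \<in> M" using True by (rule is_ideal_mult[OF M_ideal])
      have "1 \<in> M" using is_ideal_diff[OF M_ideal 2 1] by simp
      then show False using one_notin_M by simp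
    next
      case r2: False
      \<comment> \<open>As \<open>r2\<close> is invertible modulo \<open>M\<close>, membership in
        \<open>M\<close> passes from \<open>\<rho>\<close> to \<open>\<sigma>\<close> to
        \<open>\<tau>\<close>, against \<open>\<tau> * s2 + 1 \<in> M\<close>.\<close>
      have "\<rho> * r2 - a \<in> M" using c(1) by (rule dvd_b_imp_in_M)
      then have "\<rho> * r2 - a + a \<in> M" using a_in_M by (rule is_ideal_add[OF M_ideal])
      then have \<rho>: "\<rho> \<in> M" using r2 M_prime by auto
      have "\<sigma> * r2 \<in> M" using c(2) is_ideal_mult2[OF M_ideal \<rho>] by (rule M_cancel)
      then have \<sigma>: "\<sigma> \<in> M" using r2 M_prime by blast
      have "\<tau> * r2 \<in> M" using c(3) is_ideal_mult2[OF M_ideal \<sigma>] by (rule M_cancel)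
      then have "\<tau> \<in> M" using r2 M_prime by blast
      then have "\<tau> * s2 \<in> M" by (rule is_ideal_mult2[OF M_ideal])
      then show False using c(4) one_plus_notin_M by blast
    qed
  qed
qed

text \<open>The \<open>b ^ 2\<close> coefficient forces \<open>s1 * s2 \<in> M\<close>, so up to
  order of the factors \<open>cusp_no_factor_aux\<close> applies. Thus the cofactor of a prime
  factor in \<open>M\<close> lies outside \<open>M\<close>.\<close>

lemma cusp_no_factor:
  assumes eq: "f1 * f2 = a ^ 4 - b ^ 3" and f: "f1 \<in> M" "f2 \<in> M"
  shows False
proof -
  obtain r1 s1 where f1: "f1 = r1 * a + s1 * b" using f(1) by (rule M_elem)
  obtain r2 s2 where f2: "f2 = r2 * a + s2 * b" using f(2) by (rule M_elem)
  have "(r1 * r2 - a ^ 2) * a ^ 2 + (r1 * s2 + r2 * s1) * (a * b) + (s1 * s2 + b) * b ^ 2 = 0"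
    using eq unfolding f1 f2 by (simp add: algebra_simps power2_eq_square power3_eq_cube power4_eq_xxxx)
  then obtain z' where "s1 * s2 + b = a * z'" by (rule quadratic_relation)
  then have "s1 * s2 + b \<in> M" using is_ideal_mult2[OF M_ideal a_in_M] by metis
  then have "s1 * s2 \<in> M" using b_in_M by (rule M_cancel2)
  then consider "s1 \<in> M" | "s2 \<in> M" using M_prime by blast
  then show False
  proof cases
    case 1
    then show False using cusp_no_factor_aux[of r1 s1 r2 s2] eq f1 f2 by blast
  next
    case 2
    then show False using cusp_no_factor_aux[of r2 s2 r1 s1] eq f1 f2 by (simp add: mult.commute)
  qed
qed

section \<open>The ideal \<open>M ^ 2\<close> and linear algebra over the residue field of
  \<open>M\<close>\<close>

definition M2 :: "'a set" where
  "M2 = {u * a ^ 2 + v * (a * b) + w * b ^ 2 | u v w. True}"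

lemma M2I: "x = u * a ^ 2 + v * (a * b) + w * b ^ 2 \<Longrightarrow> x \<in> M2"
  unfolding M2_def by blast

lemma M2E:
  assumes "x \<in> M2"
  obtains u v w where "x = u * a ^ 2 + v * (a * b) + w * b ^ 2"
  using assms unfolding M2_def mem_Collect_eq by (elim exE conjE) (rule that)

lemma M2_ideal: "is_ideal M2"
  unfolding is_ideal_def
proof (intro conjI ballI allI)
  show "0 \<in> M2" by (rule M2I[of _ 0 0 0]) simp
next
  fix x y assume x: "x \<in> M2" and y: "y \<in> M2"
  obtain u v w where "x = u * a ^ 2 + v * (a * b) + w * b ^ 2" using x by (rule M2E)
  moreover obtain u' v' w' where "y = u' * a ^ 2 + v' * (a * b) + w' * b ^ 2" using y by (rule M2E)
  ultimately have "x + y = (u + u') * a ^ 2 + (v + v') * (a * b) + (w + w') * b ^ 2"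
    by (simp add: algebra_simps)
  then show "x + y \<in> M2" by (rule M2I)
next
  fix r x assume x: "x \<in> M2"
  obtain u v w where "x = u * a ^ 2 + v * (a * b) + w * b ^ 2" using x by (rule M2E)
  then have "r * x = (r * u) * a ^ 2 + (r * v) * (a * b) + (r * w) * b ^ 2"
    by (simp add: algebra_simps)
  then show "r * x \<in> M2" by (rule M2I)
qed

lemma M_mult_M: "x \<in> M \<Longrightarrow> y \<in> M \<Longrightarrow> x * y \<in> M2"
proof -
  assume x: "x \<in> M" and y: "y \<in> M"
  obtain u v where "x = u * a + v * b" using x by (rule M_elem)
  moreover obtain u' v' where "y = u' * a + v' * b" using y by (rule M_elem)
  ultimately have "x * y = (u * u') * a ^ 2 + (u * v' + u' * v) * (a * b) + (v * v') * b ^ 2"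
    by (simp add: algebra_simps power2_eq_square)
  then show ?thesis by (rule M2I)
qed

lemma M2_subset_M: "M2 \<subseteq> M"
proof
  fix x assume "x \<in> M2"
  then obtain u v w where "x = u * a ^ 2 + v * (a * b) + w * b ^ 2" by (rule M2E)
  then have "x = (u * a + v * b) * a + (w * b) * b" by (simp add: algebra_simps power2_eq_square)
  then show "x \<in> M" unfolding M_eq by (rule ideal2I)
qed

text \<open>\<open>M ^ 2\<close> is \<open>M\<close>-primary: if \<open>r\<close> inverts
  \<open>h\<close> modulo \<open>M\<close>, the error \<open>(1 - r * h) * x\<close> is a product of
  two elements of \<open>M\<close>.\<close>

lemma M2_cancel_unit:
  assumes h: "h \<notin> M" and x: "h * x \<in> M2"
  shows "x \<in> M2"
proof -
  obtain r where r: "1 - r * h \<in> M" using M_max h by blast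
  have "x \<in> M" using x h M_prime M2_subset_M by blast
  then have "r * (h * x) + (1 - r * h) * x \<in> M2"
    by (intro is_ideal_add[OF M2_ideal] is_ideal_mult[OF M2_ideal x] M_mult_M r)
  then show ?thesis by (simp add: algebra_simps)
qed

text \<open>The classes of \<open>a\<close> and \<open>b\<close> are independent in
  \<open>M / M ^ 2\<close>: taking one factor \<open>a\<close> or \<open>b\<close> out of each
  quadratic monomial leaves a relation to which \<open>syzygy\<close> applies.\<close>

lemma independent_mod_M2:
  assumes "c * a + d * b \<in> M2"
  shows "c \<in> M" "d \<in> M"
proof -
  obtain u v w where "c * a + d * b = u * a ^ 2 + v * (a * b) + w * b ^ 2"
    using assms by (rule M2E)
  then have "(c - (u * a + v * b)) * a + (d - w * b) * b = 0"
    by (simp add: algebra_simps power2_eq_square)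
  then obtain k where k: "d - w * b = k * a" "c - (u * a + v * b) = - (k * b)" using syzygy by blast
  have "d = k * a + w * b" using k(1) by (simp add: algebra_simps)
  then show "d \<in> M" unfolding M_eq by (rule ideal2I)
  have "c = u * a + (v - k) * b" using k(2) by (simp add: algebra_simps)
  then show "c \<in> M" unfolding M_eq by (rule ideal2I)
qed

text \<open>Three vectors in a plane over the residue field are dependent. The cross product of the
  two coordinate rows is a relation; if it vanishes modulo \<open>M\<close>, the rank is at most one
  and a relation between at most two vectors is read off a nonzero entry.\<close>

lemma linear_dependence_mod_M:
  obtains c1 c2 c3 where "c1 \<notin> M \<or> c2 \<notin> M \<or> c3 \<notin> M"
    "c1 * x1 + c2 * x2 + c3 * x3 \<in> M" "c1 * y1 + c2 * y2 + c3 * y3 \<in> M"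
proof -
  define D1 D2 D3 where D: "D1 = x2 * y3 - x3 * y2" "D2 = x3 * y1 - x1 * y3" "D3 = x1 * y2 - x2 * y1"
  have D0: "D1 * x1 + D2 * x2 + D3 * x3 = 0" "D1 * y1 + D2 * y2 + D3 * y3 = 0"
    unfolding D by (simp_all add: algebra_simps)
  consider "D1 \<notin> M \<or> D2 \<notin> M \<or> D3 \<notin> M" | "x1 \<in> M" "x2 \<in> M" "x3 \<in> M" "y1 \<in> M"
    | "D1 \<in> M" "D2 \<in> M" "D3 \<in> M" "x1 \<notin> M \<or> x2 \<notin> M"
    | "D1 \<in> M" "D2 \<in> M" "D3 \<in> M" "x3 \<notin> M"
    | "D1 \<in> M" "D2 \<in> M" "D3 \<in> M" "x1 \<in> M" "y1 \<notin> M"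
    by blast
  then show thesis
  proof cases
    case 1
    then show thesis using that[of D1 D2 D3] D0 is_ideal_0[OF M_ideal] by simp
  next
    case 2
    then show thesis using that[of 1 0 0] one_notin_M by simp
  next
    case 3
    have "x2 * y1 + (- x1) * y2 + 0 * y3 = - D3" unfolding D by (simp add: algebra_simps)
    then show thesis
      using that[of x2 "- x1" 0] 3 is_ideal_0[OF M_ideal] is_ideal_uminus[OF M_ideal]
        is_ideal_uminus[OF M_ideal, of "- x1"]
      by (metis add.inverse_inverse mult.commute add.right_inverse mult_minus_left mult_zero_left add_0_right)
  next
    case 4
    have "x3 * y1 + 0 * y2 + (- x1) * y3 = D2" unfolding D by (simp add: algebra_simps)
    then show thesis
      using that[of x3 0 "- x1"] 4 is_ideal_0[OF M_ideal] by (simp add: mult.commute)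
  next
    case 5
    have 1: "y2 * y1 + (- y1) * y2 + 0 * y3 = 0" by (simp add: algebra_simps)
    have 2: "y2 * x1 + (- y1) * x2 + 0 * x3 = D3" unfolding D by (simp add: algebra_simps)
    have "- y1 \<notin> M" using 5 is_ideal_uminus[OF M_ideal, of "- y1"] by auto
    then show thesis
      using that[of y2 "- y1" 0] 5 is_ideal_0[OF M_ideal] 1 2 by simp
  qed
qed

end

section \<open>The kernel of a rational evaluation\<close>

text \<open>For \<open>b \<noteq> 0\<close> the relation implies \<open>b ^ n * f (c / b) = r\<close>, and conversely if \<open>n \<ge> degree f\<close>.\<close>

definition eval_rel :: "'a::idom \<Rightarrow> 'a \<Rightarrow> 'a poly \<Rightarrow> nat \<Rightarrow> 'a \<Rightarrow> bool" where
  "eval_rel b c f n r \<longleftrightarrow> [:- c, b:] dvd smult (b ^ n) f - [:r:]"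

text \<open>Horner's scheme: replacing \<open>b * X\<close> by \<open>c\<close> handles one more
  coefficient at the cost of one more power of \<open>b\<close>.\<close>

lemma eval_rel_exists: "\<exists>n r. eval_rel b c f n r"
proof (induction f)
  case 0
  show ?case unfolding eval_rel_def by (intro exI[of _ 0]) simp
next
  case (pCons k f)
  then obtain n r where "[:- c, b:] dvd smult (b ^ n) f - [:r:]" unfolding eval_rel_def by blast
  then have "[:- c, b:] dvd [:0, b:] * (smult (b ^ n) f - [:r:]) + [:- c, b:] * [:r:]"
    by (intro dvd_add dvd_mult dvd_triv_left)
  also have "[:0, b:] * (smult (b ^ n) f - [:r:]) + [:- c, b:] * [:r:]
      = smult (b ^ Suc n) (pCons k f) - [:b ^ Suc n * k + c * r:]"
    by (simp add: algebra_simps)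
  finally show ?case unfolding eval_rel_def by blast
qed

lemma eval_rel_unique:
  assumes b: "b \<noteq> 0" and 1: "eval_rel b c f n r" and 2: "eval_rel b c f m s"
  shows "b ^ m * r = b ^ n * s"
proof -
  have "[:- c, b:] dvd smult (b ^ n) (smult (b ^ m) f - [:s:]) - smult (b ^ m) (smult (b ^ n) f - [:r:])"
    by (rule dvd_diff[OF dvd_smult[OF 2[unfolded eval_rel_def]] dvd_smult[OF 1[unfolded eval_rel_def]]])
  also have "\<dots> = [:b ^ m * r - b ^ n * s:]"
    by (simp add: smult_diff_right mult.commute)
  finally have d: "[:- c, b:] dvd [:b ^ m * r - b ^ n * s:]" .
  have "b ^ m * r - b ^ n * s = 0"
  proof (rule ccontr)
    assume "b ^ m * r - b ^ n * s \<noteq> 0"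
    then have "degree [:- c, b:] \<le> degree [:b ^ m * r - b ^ n * s:]"
      by (intro dvd_imp_degree_le d) simp
    then show False using b by simp
  qed
  then show ?thesis by simp
qed

lemma eval_rel_const: "eval_rel b c [:k:] 0 k"
  unfolding eval_rel_def by simp

lemma eval_rel_linear: "eval_rel b c [:\<gamma>, \<beta>:] 1 (\<beta> * c + \<gamma> * b)"
proof -
  have "smult (b ^ 1) [:\<gamma>, \<beta>:] - [:\<beta> * c + \<gamma> * b:] = [:- c, b:] * [:\<beta>:]"
    by (simp add: algebra_simps)
  then show ?thesis unfolding eval_rel_def by (metis dvd_triv_left)
qed

lemma eval_rel_square: "eval_rel b c [:s, 0, 1:] 2 (c ^ 2 + s * b ^ 2)"
proof -
  have "smult (b ^ 2) [:s, 0, 1:] - [:c ^ 2 + s * b ^ 2:] = [:- c, b:] * [:c, b:]"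
    by (simp add: algebra_simps power2_eq_square)
  then show ?thesis unfolding eval_rel_def by (metis dvd_triv_left)
qed

lemma eval_rel_add:
  assumes "eval_rel b c f n r" "eval_rel b c g m s"
  shows "eval_rel b c (f + g) (n + m) (b ^ m * r + b ^ n * s)"
proof -
  have "[:- c, b:] dvd smult (b ^ m) (smult (b ^ n) f - [:r:]) + smult (b ^ n) (smult (b ^ m) g - [:s:])"
    using assms unfolding eval_rel_def by (intro dvd_add dvd_smult)
  also have "\<dots> = smult (b ^ (n + m)) (f + g) - [:b ^ m * r + b ^ n * s:]"
    by (simp add: smult_diff_right smult_add_right power_add mult.commute)
  finally show ?thesis unfolding eval_rel_def .
qed

lemma eval_rel_mult:
  assumes "eval_rel b c f n r" "eval_rel b c g m s"
  shows "eval_rel b c (f * g) (n + m) (r * s)"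
proof -
  have "[:- c, b:] dvd (smult (b ^ n) f - [:r:]) * smult (b ^ m) g + [:r:] * (smult (b ^ m) g - [:s:])"
    using assms unfolding eval_rel_def by (intro dvd_add dvd_mult dvd_mult2)
  also have "\<dots> = smult (b ^ (n + m)) (f * g) - [:r * s:]"
    by (simp add: algebra_simps power_add smult_diff_right)
  finally show ?thesis unfolding eval_rel_def .
qed

text \<open>The kernel of \<open>R[X] \<rightarrow> Frac (R / p)\<close> sending \<open>X\<close> to \<open>c / b\<close>.\<close>

definition eval_kernel :: "'a::idom \<Rightarrow> 'a \<Rightarrow> 'a \<Rightarrow> 'a poly set" where
  "eval_kernel p b c = {f. \<exists>n r. eval_rel b c f n r \<and> p dvd r}"

context
  fixes p b c :: "'a::idom"
  assumes p: "prime_elem p" and pb: "\<not> p dvd b"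
begin

text \<open>One representation decides membership: by \<open>eval_rel_unique\<close>, two values
  \<open>r\<close> agree up to powers of \<open>b\<close>, and \<open>p\<close> does not divide
  these.\<close>

lemma eval_kernel_iff:
  assumes "eval_rel b c f n r"
  shows "f \<in> eval_kernel p b c \<longleftrightarrow> p dvd r"
proof
  assume "f \<in> eval_kernel p b c"
  then obtain m s where s: "eval_rel b c f m s" "p dvd s" unfolding eval_kernel_def by blast
  have "b \<noteq> 0" using pb by auto
  from eval_rel_unique[OF this assms s(1)] have "p dvd b ^ m * r" using s(2) by simp
  moreover have "\<not> p dvd b ^ m" using pb prime_elem_dvd_power[OF p] by blast
  ultimately show "p dvd r" using p unfolding prime_elem_def by blast
qed (use assms in \<open>auto simp: eval_kernel_def\<close>)

lemma prime_ideal_eval_kernel: "prime_ideal (eval_kernel p b c)"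
proof (rule prime_idealI)
  show "is_ideal (eval_kernel p b c)"
    unfolding is_ideal_def
  proof (intro conjI ballI allI)
    show "0 \<in> eval_kernel p b c" using eval_kernel_iff[OF eval_rel_const[of b c 0]] by simp
  next
    fix f g assume "f \<in> eval_kernel p b c" "g \<in> eval_kernel p b c"
    then obtain n r m s where "eval_rel b c f n r" "p dvd r" "eval_rel b c g m s" "p dvd s"
      unfolding eval_kernel_def by blast
    then show "f + g \<in> eval_kernel p b c"
      using eval_kernel_iff[OF eval_rel_add[of b c f n r g m s]] by simp
  next
    fix g f assume "f \<in> eval_kernel p b c"
    moreover obtain m s where "eval_rel b c g m s" using eval_rel_exists by blast
    moreover obtain n r where "eval_rel b c f n r" using eval_rel_exists by blast
    ultimately show "g * f \<in> eval_kernel p b c"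
      using eval_kernel_iff eval_rel_mult[of b c g m s f n r] by auto
  qed
  show "1 \<notin> eval_kernel p b c"
    using eval_kernel_iff[OF eval_rel_const[of b c 1]] p
    by (simp add: prime_elem_def flip: one_pCons)
  fix f g assume fg: "f * g \<in> eval_kernel p b c"
  obtain n r where r: "eval_rel b c f n r" using eval_rel_exists by blast
  obtain m s where s: "eval_rel b c g m s" using eval_rel_exists by blast
  have "p dvd r * s" using fg eval_kernel_iff[OF eval_rel_mult[OF r s]] by simp
  then show "f \<in> eval_kernel p b c \<or> g \<in> eval_kernel p b c"
    using p eval_kernel_iff[OF r] eval_kernel_iff[OF s] unfolding prime_elem_def by blast
qed

lemma linear_in_eval_kernel_iff: "[:\<gamma>, \<beta>:] \<in> eval_kernel p b c \<longleftrightarrow> p dvd \<beta> * c + \<gamma> * b"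
  by (rule eval_kernel_iff[OF eval_rel_linear])

lemma square_in_eval_kernel_iff: "[:s, 0, 1:] \<in> eval_kernel p b c \<longleftrightarrow> p dvd c ^ 2 + s * b ^ 2"
  by (rule eval_kernel_iff[OF eval_rel_square])

lemma const_in_eval_kernel: "[:p:] \<in> eval_kernel p b c"
  using eval_kernel_iff[OF eval_rel_const[of b c p]] by simp

end

section \<open>The kernel over a prime factor of \<open>a ^ 4 - b ^ 3\<close>\<close>

lemma monic_quadratic_division:
  fixes f :: "'a::comm_ring_1 poly"
  obtains H \<beta> \<gamma> where "f = [:- s, 0, 1:] * H + [:\<gamma>, \<beta>:]"
proof -
  have "\<exists>H \<beta> \<gamma>. f = [:- s, 0, 1:] * H + [:\<gamma>, \<beta>:]"
  proof (induction f)
    case 0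
    show ?case by (intro exI[of _ 0]) simp
  next
    case (pCons k f)
    then obtain H \<beta> \<gamma> where f: "f = [:- s, 0, 1:] * H + [:\<gamma>, \<beta>:]" by blast
    have "pCons k f = [:k:] + [:0, 1:] * f" by simp
    also have "\<dots> = [:k:] + [:- s, 0, 1:] * ([:0, 1:] * H) + [:0, 1:] * [:\<gamma>, \<beta>:]"
      unfolding f by (simp only: distrib_left mult.left_commute add.assoc)
    also have "\<dots> = [:- s, 0, 1:] * ([:0, 1:] * H) + ([:k:] + [:0, \<gamma>, \<beta>:])"
      by (simp only: mult_pCons_left mult_pCons_right) simp
    also have "[:k:] + [:0, \<gamma>, \<beta>:] = [:- s, 0, 1:] * [:\<beta>:] + [:k + s * \<beta>, \<gamma>:]"
      by simp
    also have "[:- s, 0, 1:] * ([:0, 1:] * H) + \<dots> = [:- s, 0, 1:] * ([:0, 1:] * H + [:\<beta>:]) + [:k + s * \<beta>, \<gamma>:]"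
      by (simp only: distrib_left add.assoc)
    finally show ?case by blast
  qed
  then show thesis using that by blast
qed

context regular_maximal_ideal
begin

text \<open>The cusp equation makes divisibility of \<open>a\<close> and of \<open>b\<close>
  equivalent. A common factor \<open>p\<close> gives the relation \<open>b' * a - a' * b = 0\<close>
  between the cofactors, and \<open>syzygy\<close> then makes \<open>p\<close> a unit, although it
  lies in \<open>M\<close>.\<close>

lemma prime_factor_not_dvd:
  assumes p: "prime_elem p" "p \<in> M" "p dvd a ^ 4 - b ^ 3"
  shows "\<not> p dvd a" "\<not> p dvd b"
proof -
  have iff: "p dvd a \<longleftrightarrow> p dvd b"
  proof
    assume "p dvd a"
    then have "p dvd a ^ 4" using dvd_trans[OF _ dvd_power[of 4 a]] by simp
    then have "p dvd a ^ 4 - (a ^ 4 - b ^ 3)" using p(3) by (rule dvd_diff)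
    then show "p dvd b" using prime_elem_dvd_power[OF p(1)] by simp
  next
    assume "p dvd b"
    then have "p dvd b ^ 3" using dvd_trans[OF _ dvd_power[of 3 b]] by simp
    with p(3) have "p dvd (a ^ 4 - b ^ 3) + b ^ 3" by (rule dvd_add)
    then show "p dvd a" using prime_elem_dvd_power[OF p(1)] by simp
  qed
  have a0: "a \<noteq> 0"
  proof
    assume "a = 0"
    then have "1 * a + 0 * b = 0" by simp
    then obtain w where "1 = - (w * b)" using syzygy by blast
    then have "1 \<in> M" using is_ideal_uminus[OF M_ideal is_ideal_mult[OF M_ideal b_in_M, of w]] by simp
    then show False using one_notin_M by blast
  qed
  have "\<not> (p dvd a \<and> p dvd b)"
  proof
    assume "p dvd a \<and> p dvd b"
    then obtain a' b' where ab: "a = p * a'" "b = p * b'" unfolding dvd_def by blast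
    have "b' * (p * a') + (- a') * (p * b') = 0" by (simp add: algebra_simps)
    then have "b' * a + (- a') * b = 0" by (simp only: ab[symmetric])
    then obtain w where w: "- a' = w * a" using syzygy by blast
    have "a' * (w * p + 1) = w * (p * a') + a'" by (simp add: algebra_simps)
    also have "\<dots> = 0" unfolding ab(1)[symmetric] w[symmetric] by simp
    finally have "a' * (w * p + 1) = 0" .
    moreover have "a' \<noteq> 0"
    proof
      assume "a' = 0"
      then have "a = 0" using ab(1) by simp
      then show False using a0 by blast
    qed
    ultimately have "w * p + 1 = 0" by simp
    moreover have "w * p + 1 \<notin> M" by (intro one_plus_notin_M is_ideal_mult[OF M_ideal] p(2))
    ultimately show False using is_ideal_0[OF M_ideal] by simp
  qed
  then show "\<not> p dvd a" "\<not> p dvd b" using iff by blast+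
qed

lemma eval_kernel_coeffs:
  assumes p: "prime_elem p" "p \<in> M" and F: "a ^ 4 - b ^ 3 = p * h" and h: "h \<notin> M"
    and q: "q \<in> eval_kernel p b (a ^ 3)"
  shows "coeff q 0 \<in> M2" "coeff q 1 \<in> M"
proof -
  have pb: "\<not> p dvd b" by (rule prime_factor_not_dvd[OF p]) (simp add: F)
  note P = prime_ideal_eval_kernel[OF p(1) pb, of "a ^ 3"]
  note PI = prime_idealD(1)[OF P]
  define s where "s = a ^ 2 * b"
  have s: "s \<in> M2" unfolding s_def by (rule M2I[of _ 0 a 0]) (simp add: power2_eq_square)
  obtain H \<beta> \<gamma> where H: "q = [:- s, 0, 1:] * H + [:\<gamma>, \<beta>:]" by (rule monic_quadratic_division)
  have "(a ^ 3) ^ 2 + (- s) * b ^ 2 = a ^ 2 * (a ^ 4 - b ^ 3)"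
    unfolding s_def by (simp add: algebra_simps flip: power_add power_mult power_Suc2 power_Suc)
  then have "p dvd (a ^ 3) ^ 2 + (- s) * b ^ 2" unfolding F by simp
  then have "[:- s, 0, 1:] \<in> eval_kernel p b (a ^ 3)"
    using square_in_eval_kernel_iff[OF p(1) pb] by blast
  then have "q - [:- s, 0, 1:] * H \<in> eval_kernel p b (a ^ 3)"
    by (intro is_ideal_diff[OF PI q] is_ideal_mult2[OF PI])
  then have "p dvd \<beta> * a ^ 3 + \<gamma> * b"
    unfolding H using linear_in_eval_kernel_iff[OF p(1) pb] by simp
  then obtain w where w: "\<beta> * a ^ 3 + \<gamma> * b = p * w" by (elim dvdE)
  \<comment> \<open>Multiplication by \<open>h\<close> replaces \<open>p\<close> by
    \<open>a ^ 4 - b ^ 3\<close>, which turns the divisibility into a relation between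
    \<open>a ^ 3\<close> and \<open>b\<close>. Since \<open>h\<close> is outside \<open>M\<close>,
    it cancels afterwards.\<close>
  have "(h * \<beta> - a * w) * a ^ 3 + (h * \<gamma> + b ^ 2 * w) * b
      = h * (\<beta> * a ^ 3 + \<gamma> * b) - (a ^ 4 - b ^ 3) * w"
    by (simp add: algebra_simps power2_eq_square power3_eq_cube power4_eq_xxxx)
  also have "\<dots> = 0" unfolding w F by (simp add: algebra_simps)
  finally obtain y where y: "h * \<gamma> + b ^ 2 * w = y * a ^ 3" "h * \<beta> - a * w = - (y * b)"
    using syzygy_a_power by blast
  have "h * \<beta> = w * a + (- y) * b" using y(2) by (simp add: algebra_simps)
  then have "h * \<beta> \<in> M" unfolding M_eq by (rule ideal2I)
  then have \<beta>: "\<beta> \<in> M" using h M_prime by blast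
  have "h * \<gamma> = (y * a) * a ^ 2 + 0 * (a * b) + (- w) * b ^ 2"
    using y(1) by (simp add: algebra_simps power2_eq_square power3_eq_cube eq_diff_eq)
  then have "h * \<gamma> \<in> M2" by (rule M2I)
  then have \<gamma>: "\<gamma> \<in> M2" by (rule M2_cancel_unit[OF h])
  have "coeff q 0 = \<gamma> - coeff H 0 * s" unfolding H by (simp add: mult.commute)
  also have "\<dots> \<in> M2" by (intro is_ideal_diff[OF M2_ideal] \<gamma> is_ideal_mult[OF M2_ideal] s)
  finally show "coeff q 0 \<in> M2" .
  have "coeff q 1 = \<beta> - coeff H 1 * s" unfolding H by (simp add: mult.commute)
  also have "\<dots> \<in> M"
    using s M2_subset_M by (intro is_ideal_diff[OF M_ideal] \<beta> is_ideal_mult[OF M_ideal]) blast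
  finally show "coeff q 1 \<in> M" .
qed

text \<open>With two generators, some combination of \<open>e1\<close>, \<open>e2\<close>,
  \<open>e3\<close> with coefficients not all in \<open>M\<close> has cofactors \<open>G\<close>,
  \<open>K\<close> with constant term in \<open>M\<close>. By \<open>eval_kernel_coeffs\<close> its
  coefficient at \<open>X\<close> lies in \<open>M ^ 2\<close> and that at \<open>X ^ 2\<close> in
  \<open>M\<close>; these are \<open>c2 * a + c3 * b\<close> and \<open>c1\<close>.\<close>

lemma eval_kernel_not_two_generated:
  assumes p: "prime_elem p" "p \<in> M" and F: "a ^ 4 - b ^ 3 = p * h" and h: "h \<notin> M"
  shows "eval_kernel p b (a ^ 3) \<noteq> ideal2 f g"
proof
  assume fg: "eval_kernel p b (a ^ 3) = ideal2 f g"
  have pb: "\<not> p dvd b" by (rule prime_factor_not_dvd[OF p]) (simp add: F)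
  have pF: "p dvd a ^ 4 - b ^ 3" unfolding F by simp
  \<comment> \<open>Up to sign these are the 2x2 minors of the matrix with rows
    \<open>(a, b, X)\<close> and \<open>(b, X, a ^ 2)\<close>.\<close>
  define e1 e2 e3 where e: "e1 = [:- (a ^ 2 * b), 0, 1:]" "e2 = [:- (b ^ 2), a:]" "e3 = [:- (a ^ 3), b:]"
  have "(a ^ 3) ^ 2 + (- (a ^ 2 * b)) * b ^ 2 = a ^ 2 * (a ^ 4 - b ^ 3)"
    by (simp add: algebra_simps flip: power_add power_mult power_Suc2 power_Suc)
  then have "e1 \<in> ideal2 f g"
    unfolding e fg[symmetric] square_in_eval_kernel_iff[OF p(1) pb] using pF by simp
  then obtain A1 B1 where 1: "e1 = A1 * f + B1 * g" by (rule ideal2E)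
  have "a * a ^ 3 + (- (b ^ 2)) * b = a ^ 4 - b ^ 3"
    by (simp add: power2_eq_square power3_eq_cube power4_eq_xxxx)
  then have "e2 \<in> ideal2 f g"
    unfolding e fg[symmetric] linear_in_eval_kernel_iff[OF p(1) pb] using pF by simp
  then obtain A2 B2 where 2: "e2 = A2 * f + B2 * g" by (rule ideal2E)
  have "e3 \<in> ideal2 f g"
    unfolding e fg[symmetric] linear_in_eval_kernel_iff[OF p(1) pb] by (simp add: mult.commute)
  then obtain A3 B3 where 3: "e3 = A3 * f + B3 * g" by (rule ideal2E)
  obtain c1 c2 c3 where c: "c1 \<notin> M \<or> c2 \<notin> M \<or> c3 \<notin> M"
    "c1 * coeff A1 0 + c2 * coeff A2 0 + c3 * coeff A3 0 \<in> M"
    "c1 * coeff B1 0 + c2 * coeff B2 0 + c3 * coeff B3 0 \<in> M"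
    by (rule linear_dependence_mod_M)
  define G where "G = smult c1 A1 + smult c2 A2 + smult c3 A3"
  define K where "K = smult c1 B1 + smult c2 B2 + smult c3 B3"
  have G0: "coeff G 0 \<in> M" and K0: "coeff K 0 \<in> M" using c(2,3) unfolding G_def K_def by simp_all
  have E: "smult c1 e1 + smult c2 e2 + smult c3 e3 = G * f + K * g"
    unfolding G_def K_def 1 2 3 by (simp add: algebra_simps smult_add_right)
  have f: "coeff f 0 \<in> M2" "coeff f 1 \<in> M" and g: "coeff g 0 \<in> M2" "coeff g 1 \<in> M"
    using eval_kernel_coeffs[OF p F h] ideal2_gens[of f g] ideal2_gens[of g f] unfolding fg by blast+
  have c1: "coeff (S * q) 1 \<in> M2" and c2: "coeff (S * q) 2 \<in> M"
    if S: "coeff S 0 \<in> M" and q: "coeff q 0 \<in> M2" "coeff q 1 \<in> M" for S q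
  proof -
    have "coeff (S * q) 1 = coeff S 0 * coeff q 1 + coeff S 1 * coeff q 0"
      by (simp add: coeff_mult)
    also have "\<dots> \<in> M2" by (intro is_ideal_add[OF M2_ideal] M_mult_M S q is_ideal_mult[OF M2_ideal])
    finally show "coeff (S * q) 1 \<in> M2" .
    have "coeff (S * q) 2 = coeff S 0 * coeff q 2 + coeff S 1 * coeff q 1 + coeff S 2 * coeff q 0"
      by (simp add: coeff_mult numeral_2_eq_2)
    also have "\<dots> \<in> M"
      by (intro is_ideal_add[OF M_ideal] is_ideal_mult2[OF M_ideal S] is_ideal_mult[OF M_ideal] q
        subsetD[OF M2_subset_M])
    finally show "coeff (S * q) 2 \<in> M" .
  qed
  have "coeff (G * f + K * g) 1 \<in> M2"
    unfolding coeff_add by (intro is_ideal_add[OF M2_ideal] c1 G0 K0 f g)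
  then have "c2 * a + c3 * b \<in> M2" unfolding E[symmetric] e by simp
  then have "c2 \<in> M" "c3 \<in> M" by (rule independent_mod_M2)+
  moreover have "coeff (G * f + K * g) 2 \<in> M"
    unfolding coeff_add by (intro is_ideal_add[OF M_ideal] c2 G0 K0 f g)
  then have "c1 \<in> M" unfolding E[symmetric] e by (simp add: numeral_2_eq_2)
  ultimately show False using c(1) by blast
qed

text \<open>Supplies the second constant of the regular sequence \<open>p\<close>, \<open>c\<close>,
  \<open>X ^ 2 - a ^ 2 * b\<close>. If \<open>a\<close> is not in \<open>N\<close>, a norm
  \<open>d\<close> congruent to 1 modulo \<open>a\<close> is taken; it lies outside
  \<open>M\<close>, hence is no multiple of \<open>p\<close>.\<close>

lemma eval_kernel_maximal_over:
  assumes p: "prime_elem p" "p \<in> M" "p dvd a ^ 4 - b ^ 3"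
    and N: "is_ideal N" "eval_kernel p b (a ^ 3) \<subseteq> N" "\<And>y. y \<notin> N \<Longrightarrow> \<exists>r. 1 - r * y \<in> N"
  obtains c where "\<not> p dvd c" "[:c:] \<in> N"
proof (cases "[:a:] \<in> N")
  case True
  then show thesis using that prime_factor_not_dvd[OF p] by blast
next
  case False
  note pb = prime_factor_not_dvd(2)[OF p]
  define s where "s = a ^ 2 * b"
  have "(a ^ 3) ^ 2 + (- s) * b ^ 2 = a ^ 2 * (a ^ 4 - b ^ 3)"
    unfolding s_def by (simp add: algebra_simps flip: power_add power_mult power_Suc2 power_Suc)
  then have "[:- s, 0, 1:] \<in> N"
    using square_in_eval_kernel_iff[OF p(1) pb, of "- s"] p(3) N(2) by auto
  \<comment> \<open>Multiplying \<open>1 - r a\<close> by its conjugate over \<open>R[X] / (X^2 - s)\<close> gives an element of \<open>N \<inter> R\<close>.\<close>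
  obtain r where r: "1 - r * [:a:] \<in> N" using N(3)[OF False] by blast
  obtain H r1 r0 where H: "r = [:- s, 0, 1:] * H + [:r0, r1:]" by (rule monic_quadratic_division)
  define d where "d = (1 - a * r0) ^ 2 - a ^ 2 * r1 ^ 2 * s"
  have "(1 - r * [:a:]) + [:- s, 0, 1:] * (H * [:a:]) = [:1 - a * r0, - (a * r1):]"
    unfolding H by (simp add: algebra_simps one_pCons)
  moreover have "(1 - r * [:a:]) + [:- s, 0, 1:] * (H * [:a:]) \<in> N"
    by (intro is_ideal_add[OF N(1)] r is_ideal_mult2[OF N(1)] \<open>[:- s, 0, 1:] \<in> N\<close>)
  ultimately have "[:1 - a * r0, - (a * r1):] * [:1 - a * r0, a * r1:] + [:- s, 0, 1:] * [:(a * r1) ^ 2:] \<in> N"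
    by (intro is_ideal_add[OF N(1)] is_ideal_mult2[OF N(1)] \<open>[:- s, 0, 1:] \<in> N\<close>) simp
  also have "[:1 - a * r0, - (a * r1):] * [:1 - a * r0, a * r1:] + [:- s, 0, 1:] * [:(a * r1) ^ 2:] = [:d:]"
    unfolding d_def by (simp add: algebra_simps power2_eq_square)
  finally have dN: "[:d:] \<in> N" .
  have d1: "d + a * (2 * r0 - a * r0 ^ 2 + a * r1 ^ 2 * s) = 1"
    unfolding d_def by (simp add: algebra_simps power2_eq_square)
  have "d \<notin> M"
  proof
    assume "d \<in> M"
    then have "d + a * (2 * r0 - a * r0 ^ 2 + a * r1 ^ 2 * s) \<in> M"
      by (intro is_ideal_add[OF M_ideal] is_ideal_mult2[OF M_ideal a_in_M])
    then show False using one_notin_M unfolding d1 by blast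
  qed
  then have "\<not> p dvd d" using is_ideal_mult2[OF M_ideal p(2)] by (auto elim!: dvdE)
  then show thesis using that dN by blast
qed

end

section \<open>Two-dimensional factorial domains of finite character\<close>

lemma prime_chain_le_krull_dim:
  fixes Q0 Q1 Q2 Q3 :: "'a::comm_ring_1 set"
  assumes "prime_ideal Q0" "prime_ideal Q1" "prime_ideal Q2" "prime_ideal Q3"
    and "Q0 \<subset> Q1" "Q1 \<subset> Q2" "Q2 \<subset> Q3"
  shows "3 \<le> krull_dim TYPE('a)"
proof -
  define f where "f i = (if i = 0 then Q0 else if i = 1 then Q1 else if i = 2 then Q2 else Q3)" for i :: nat
  have "\<forall>i\<le>3. prime_ideal (f i)" using assms unfolding f_def by simp
  moreover have "\<forall>i<3. f i \<subset> f (Suc i)"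
  proof (intro allI impI)
    fix i :: nat assume "i < 3"
    then consider "i = 0" | "i = 1" | "i = 2" by linarith
    then show "f i \<subset> f (Suc i)" by cases (use assms in \<open>simp_all add: f_def\<close>)
  qed
  moreover have "f 3 = Q3" unfolding f_def by simp
  ultimately have "enat 3 \<le> prime_height Q3"
    unfolding prime_height_def by (intro Sup_upper) blast
  also have "\<dots> \<le> krull_dim TYPE('a)" unfolding krull_dim_def using assms(4) by (intro SUP_upper) simp
  finally show ?thesis by (simp add: numeral_eq_enat)
qed

lemma krull_dim_2_chain:
  assumes "krull_dim TYPE('a::comm_ring_1) = 2"
  obtains Q0 Q1 Q2 :: "'a::comm_ring_1 set" where "prime_ideal Q0" "prime_ideal Q1" "prime_ideal Q2" "Q0 \<subset> Q1" "Q1 \<subset> Q2"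
proof -
  \<comment> \<open>The strict bound yields a chain of length at least two, whose first three
    members suffice.\<close>
  have "enat 1 < krull_dim TYPE('a)" unfolding assms by (simp add: numeral_eq_enat)
  then obtain P :: "'a set" where "prime_ideal P" "enat 1 < prime_height P"
    unfolding krull_dim_def less_SUP_iff by blast
  then obtain n f where f: "enat 1 < enat n" "\<And>i. i \<le> n \<Longrightarrow> prime_ideal (f i :: 'a set)"
    "\<And>i. i < n \<Longrightarrow> f i \<subset> f (Suc i)"
    unfolding prime_height_def less_Sup_iff by blast
  then have n: "1 < n" by simp
  show thesis
    by (rule that[of "f 0" "f 1" "f 2"]) (use f(2)[of 0] f(2)[of 1] f(2)[of 2] f(3)[of 0] f(3)[of 1] n in \<open>simp_all add: numeral_2_eq_2\<close>)
qed

lemma prime_ideal_prod_notin: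
  assumes P: "prime_ideal P" and "finite S" "\<And>i. i \<in> S \<Longrightarrow> f i \<notin> P"
  shows "prod f S \<notin> P"
  using assms(2,3) by (induction S rule: finite_induct) (use prime_idealD[OF P] in auto)

text \<open>\<open>M\<close> ends a prime chain of length two and \<open>p\<close> is a prime
  element of the middle term. Finite character leaves finitely many other maximal ideals over
  \<open>p\<close>; an element \<open>c\<close> of \<open>M\<close> avoiding them makes
  \<open>M\<close> the only prime over \<open>(p, c)\<close>.\<close>

lemma two_dimensional_maximal_ideal:
  assumes fc: "finite_character TYPE('a :: {factorial_semiring, idom})"
    and dim: "krull_dim TYPE('a) = 2"
  obtains M :: "'a :: {factorial_semiring, idom} set" and p c where "prime_ideal M" "\<And>y. y \<notin> M \<Longrightarrow> \<exists>r. 1 - r * y \<in> M"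
    "prime_elem p" "\<not> p dvd c" "M = rad (ideal2 p c)"
proof -
  obtain Q0 Q1 M :: "'a set" where Q: "prime_ideal Q0" "prime_ideal Q1" and M: "prime_ideal M"
    and Q01: "Q0 \<subset> Q1" and Q1M: "Q1 \<subset> M"
    using dim by (rule krull_dim_2_chain)
  note MI = prime_idealD(1)[OF M]
  have "0 \<in> Q0" by (rule is_ideal_0[OF prime_idealD(1)[OF Q(1)]])
  then obtain x where "x \<in> Q1" "x \<noteq> 0" using Q01 by blast
  then obtain p where p: "prime_elem p" "p \<in> Q1"
    using prime_ideal_contains_prime_elem[OF Q(2)] by blast
  have pQ1: "{x. p dvd x} \<subseteq> Q1"
    using is_ideal_mult2[OF prime_idealD(1)[OF Q(2)] p(2)] by (auto elim!: dvdE)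
  have pM: "p \<in> M" using p(2) Q1M by blast
  obtain y where y: "y \<in> M" "\<not> p dvd y" using pQ1 Q1M by blast
  \<comment> \<open>Such primes would extend \<open>0\<close> and the principal prime generated by
    \<open>p\<close> to a chain of length three.\<close>
  have no_chain: False if "prime_ideal Q" "prime_ideal Q'" "Q \<subset> Q'" "p \<in> Q" "z \<in> Q" "\<not> p dvd z" for Q Q' z
  proof -
    have "{x. p dvd x} \<subset> Q"
      using is_ideal_mult2[OF prime_idealD(1)[OF that(1)] that(4)] that(5,6) by (auto elim!: dvdE)
    moreover have "{0} \<subset> {x. p dvd x}" using p(1) by (auto simp: prime_elem_def)
    ultimately have "3 \<le> krull_dim TYPE('a)"
      using prime_chain_le_krull_dim[OF prime_ideal_zero prime_ideal_principal[OF p(1)] that(1,2)] that(3) by blast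
    then show False unfolding dim by simp
  qed
  have max: "\<exists>r. 1 - r * z \<in> M" if z: "z \<notin> M" for z
  proof (rule ccontr)
    assume no: "\<nexists>r. 1 - r * z \<in> M"
    define J where "J = {w. \<exists>r. w - r * z \<in> M}"
    have "is_ideal J"
      unfolding J_def by (rule is_ideal_adjoin[OF MI])
    moreover have "1 \<notin> J" using no unfolding J_def by blast
    ultimately obtain Q' where "prime_ideal Q'" "J \<subseteq> Q'" by (rule ex_maximal_ideal)
    moreover have "M \<subseteq> J" unfolding J_def by (auto intro!: exI[of _ 0])
    moreover have "z \<in> J" unfolding J_def using is_ideal_0[OF MI] by (auto intro!: exI[of _ 1])
    ultimately show False using no_chain[of M Q' y] M pM y z by blast
  qed
  have M_maximal: "maximal_ideal M"
    unfolding maximal_ideal_def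
  proof (intro conjI allI impI)
    show "is_ideal M" by (rule MI)
    show "M \<noteq> UNIV" using prime_idealD(2)[OF M] by blast
    fix J assume J: "is_ideal J" "M \<subseteq> J"
    show "J = M \<or> J = UNIV"
    proof (cases "J = M")
      case False
      then obtain z where z: "z \<in> J" "z \<notin> M" using J(2) by blast
      then obtain r where "1 - r * z \<in> M" using max by blast
      then have "(1 - r * z) + r * z \<in> J"
        using J z by (intro is_ideal_add[OF J(1)] is_ideal_mult[OF J(1)]) blast+
      then show ?thesis using is_ideal_UNIV_iff[OF J(1)] by simp
    qed simp
  qed
  define T where "T = {M'. maximal_ideal M' \<and> p \<in> M'} - {M}"
  have "p \<noteq> 0" using p(1) unfolding prime_elem_def by blast
  then have fT: "finite T" using fc unfolding finite_character_def T_def by blast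
  \<comment> \<open>Each \<open>M'\<close> in \<open>T\<close> has an element outside
    \<open>M\<close>; some multiple of their product is 1 modulo \<open>M\<close>, and
    \<open>c\<close> is 1 minus that multiple. As \<open>p\<close> lies in every \<open>M'\<close>
    and \<open>c\<close> in none, \<open>p\<close> does not divide \<open>c\<close>. For empty
    \<open>T\<close>, \<open>y\<close> serves.\<close>
  have "\<exists>c. c \<in> M \<and> \<not> p dvd c \<and> (\<forall>M'\<in>T. c \<notin> M')"
  proof (cases "T = {}")
    case True
    then show ?thesis using y by blast
  next
    case False
    have T: "is_ideal M'" "M' \<noteq> UNIV" "p \<in> M'" "\<exists>x. x \<in> M' \<and> x \<notin> M" if "M' \<in> T" for M'
      using that MI prime_idealD(2)[OF M] unfolding T_def maximal_ideal_def by blast+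
    then obtain g where g: "\<And>M'. M' \<in> T \<Longrightarrow> g M' \<in> M' \<and> g M' \<notin> M" by metis
    have "prod g T \<notin> M" using g by (intro prime_ideal_prod_notin[OF M fT]) blast
    then obtain r where r: "1 - r * prod g T \<in> M" using max by blast
    have c: "1 - r * prod g T \<notin> M'" if M': "M' \<in> T" for M'
    proof
      assume "1 - r * prod g T \<in> M'"
      moreover have "prod g T \<in> M'"
        unfolding prod.remove[OF fT M'] using is_ideal_mult2[OF T(1)[OF M']] g[OF M'] by blast
      ultimately have "(1 - r * prod g T) + r * prod g T \<in> M'"
        by (intro is_ideal_add[OF T(1)[OF M']] is_ideal_mult[OF T(1)[OF M']])
      then show False using T(2)[OF M'] is_ideal_UNIV_iff[OF T(1)[OF M']] by simp
    qed
    moreover have "\<not> p dvd 1 - r * prod g T"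
    proof
      assume pd: "p dvd 1 - r * prod g T"
      obtain M' where M': "M' \<in> T" using False by blast
      then have "1 - r * prod g T \<in> M'"
        using pd is_ideal_mult2[OF T(1)[OF M'] T(3)[OF M']] by (metis dvdE)
      then show False using c[OF M'] by blast
    qed
    ultimately show ?thesis using r by blast
  qed
  then obtain c where c: "c \<in> M" "\<not> p dvd c" "\<And>M'. M' \<in> T \<Longrightarrow> c \<notin> M'" by blast
  have "M = rad (ideal2 p c)"
  proof
    have "ideal2 p c \<subseteq> M" using MI pM c(1) by (rule ideal2_least)
    then show "rad (ideal2 p c) \<subseteq> M" unfolding rad_def using prime_ideal_power[OF M] by blast
    show "M \<subseteq> rad (ideal2 p c)"
    proof (rule ccontr)
      assume "\<not> M \<subseteq> rad (ideal2 p c)"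
      then obtain x where x: "x \<in> M" "x \<notin> rad (ideal2 p c)" by blast
      obtain Q where Q: "prime_ideal Q" "ideal2 p c \<subseteq> Q" "x \<notin> Q"
        using ex_prime_ideal_not_in_rad[OF is_ideal_ideal2 x(2)] by blast
      have pc: "p \<in> Q" "c \<in> Q" using Q(2) ideal2_gens by blast+
      obtain M' where M': "maximal_ideal M'" "Q \<subseteq> M'"
        using ex_maximal_ideal[OF prime_idealD(1,2)[OF Q(1)]] by blast
      then have "M' \<notin> T" using c(3) pc by blast
      then have "M' = M" using M' pc unfolding T_def by blast
      then show False using no_chain[of Q M c] Q M M'(2) pc c(2) x(1) by blast
    qed
  qed
  then show thesis using that[OF M max p(1) c(2)] by blast
qed

section \<open>The primes \<open>(M, X)\<close> and \<open>M[X]\<close> of the polynomial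
  ring\<close>

lemma prime_ideal_const_coeff:
  assumes M: "prime_ideal M"
  shows "prime_ideal {f. coeff f 0 \<in> M}"
proof (rule prime_idealI)
  show "is_ideal {f. coeff f 0 \<in> M}"
    unfolding is_ideal_def using prime_idealD(1)[OF M]
    by (auto simp: coeff_mult_0 is_ideal_0 is_ideal_add is_ideal_mult)
qed (use prime_idealD[OF M] in \<open>auto simp: coeff_mult_0\<close>)

text \<open>If \<open>m\<close> and \<open>n\<close> are the largest indices of coefficients outside
  \<open>M\<close>, the coefficient of the product at \<open>m + n\<close> is their product modulo
  \<open>M\<close>.\<close>

lemma prime_ideal_coeffs:
  assumes M: "prime_ideal M"
  shows "prime_ideal {f. \<forall>i. coeff f i \<in> M}"
proof (rule prime_idealI)
  note MI = prime_idealD(1)[OF M]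
  show "is_ideal {f. \<forall>i. coeff f i \<in> M}"
    unfolding is_ideal_def
    by (auto simp: coeff_mult intro: is_ideal_0[OF MI] is_ideal_add[OF MI] is_ideal_mult[OF MI] is_ideal_sum[OF MI])
  have "coeff 1 0 \<notin> M" using prime_idealD(2)[OF M] by simp
  then show "1 \<notin> {f. \<forall>i. coeff f i \<in> M}" by blast
  fix f g assume fg: "f * g \<in> {f. \<forall>i. coeff f i \<in> M}"
  show "f \<in> {f. \<forall>i. coeff f i \<in> M} \<or> g \<in> {f. \<forall>i. coeff f i \<in> M}"
  proof (rule ccontr)
    assume neg: "\<not> (f \<in> {f. \<forall>i. coeff f i \<in> M} \<or> g \<in> {f. \<forall>i. coeff f i \<in> M})"
    have top: "\<exists>m. coeff q m \<notin> M \<and> (\<forall>j>m. coeff q j \<in> M)" if "\<exists>i. coeff q i \<notin> M" for q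
    proof -
      have "{i. coeff q i \<notin> M} \<subseteq> {..degree q}"
        using is_ideal_0[OF MI] by (auto intro: le_degree)
      then have fin: "finite {i. coeff q i \<notin> M}" by (rule finite_subset) simp
      then have "Max {i. coeff q i \<notin> M} \<in> {i. coeff q i \<notin> M}" using that by (intro Max_in) auto
      moreover have "coeff q j \<in> M" if "j > Max {i. coeff q i \<notin> M}" for j
        using Max_ge[OF fin, of j] that by auto
      ultimately show ?thesis by blast
    qed
    obtain m where m: "coeff f m \<notin> M" "\<And>j. j > m \<Longrightarrow> coeff f j \<in> M" using top[of f] neg by blast
    obtain n where n: "coeff g n \<notin> M" "\<And>j. j > n \<Longrightarrow> coeff g j \<in> M" using top[of g] neg by blast
    have "coeff (f * g) (m + n) = (\<Sum>k\<le>m + n. coeff f k * coeff g (m + n - k))" by (rule coeff_mult)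
    also have "\<dots> = coeff f m * coeff g (m + n - m) + (\<Sum>k\<in>{..m + n} - {m}. coeff f k * coeff g (m + n - k))"
      by (rule sum.remove) auto
    finally have "coeff f m * coeff g n
        = coeff (f * g) (m + n) - (\<Sum>k\<in>{..m + n} - {m}. coeff f k * coeff g (m + n - k))" by simp
    also have "\<dots> \<in> M"
    proof (intro is_ideal_diff[OF MI] is_ideal_sum[OF MI])
      show "coeff (f * g) (m + n) \<in> M" using fg by blast
      fix k assume "k \<in> {..m + n} - {m}"
      then consider "k < m" | "k > m" by fastforce
      then show "coeff f k * coeff g (m + n - k) \<in> M"
      proof cases
        case 1
        then show ?thesis by (intro is_ideal_mult[OF MI] n) simp
      next
        case 2
        then show ?thesis by (intro is_ideal_mult2[OF MI] m)
      qed
    qed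
    finally show False using prime_idealD(3)[OF M] m(1) n(1) by blast
  qed
qed

text \<open>The generators are \<open>p\<close>, \<open>c\<close> and \<open>X\<close>: some power
  of \<open>f\<close> has its constant term in \<open>(p, c)\<close>, and the rest is a multiple of
  \<open>X\<close>.\<close>

lemma rad_const_coeff_three_generated:
  fixes M :: "'a::comm_ring_1 set"
  assumes M: "prime_ideal M" and rad: "M = rad (ideal2 p c)"
  shows "\<exists>\<theta>. rad {f. coeff f 0 \<in> M} = rad (gen_by 3 \<theta>)"
proof -
  define \<theta> where "\<theta> i = (if i = 0 then [:p:] else if i = 1 then [:c:] else [:0, 1:])" for i :: nat
  have "{..<3::nat} = {0, 1, 2}" by auto
  then have img: "\<theta> ` {..<3} = {[:p:], [:c:], [:0, 1:]}" unfolding \<theta>_def by auto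
  define G where "G = gen_by 3 \<theta>"
  have G: "is_ideal G" unfolding G_def gen_by_def by (rule is_ideal_gen_ideal)
  have gens: "[:p:] \<in> G" "[:c:] \<in> G" "[:0, 1:] \<in> G"
    using gen_ideal_superset[of "\<theta> ` {..<3}"] unfolding G_def gen_by_def img by auto
  note N = prime_ideal_const_coeff[OF M]
  have "ideal2 p c \<subseteq> M" unfolding rad rad_def by (auto intro: exI[of _ 1])
  then have "p \<in> M" "c \<in> M" using ideal2_gens by blast+
  then have "G \<subseteq> {f. coeff f 0 \<in> M}"
    unfolding G_def gen_by_def img using is_ideal_0[OF prime_idealD(1)[OF M]]
    by (intro gen_ideal_least prime_idealD(1)[OF N]) auto
  then have 1: "rad G \<subseteq> {f. coeff f 0 \<in> M}"
    unfolding rad_def using prime_ideal_power[OF N] by blast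
  have 2: "f \<in> rad G" if f: "coeff f 0 \<in> M" for f
  proof -
    obtain k where "coeff f 0 ^ k \<in> ideal2 p c" using f unfolding rad rad_def by blast
    then obtain u v where uv: "coeff f 0 ^ k = u * p + v * c" by (rule ideal2E)
    obtain t g where tg: "f ^ k = pCons t g" by (cases "f ^ k")
    have "t = coeff f 0 ^ k" using arg_cong[OF tg, of "\<lambda>q. coeff q 0"] by (simp add: coeff_0_power)
    then have "f ^ k = [:u:] * [:p:] + [:v:] * [:c:] + g * [:0, 1:]" unfolding tg uv by simp
    also have "\<dots> \<in> G" by (intro is_ideal_add[OF G] is_ideal_mult[OF G] gens)
    finally show ?thesis unfolding rad_def by blast
  qed
  have "rad {f. coeff f 0 \<in> M} = rad G" unfolding rad_prime_ideal[OF N] using 1 2 by blast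
  then show ?thesis unfolding G_def by blast
qed

text \<open>\<open>N\<close> is larger than \<open>M[X]\<close>, because \<open>X\<close> is not
  invertible modulo \<open>M[X]\<close>. An element of \<open>N\<close> outside \<open>M[X]\<close>
  of least degree has leading coefficient outside \<open>M\<close>, which can be normalized modulo
  \<open>M\<close>.\<close>

lemma monic_in_ideal_over_coeffs:
  fixes M :: "'a::comm_ring_1 set"
  assumes M: "prime_ideal M" and M_max: "\<And>y. y \<notin> M \<Longrightarrow> \<exists>r. 1 - r * y \<in> M"
    and N: "is_ideal N" "{f. \<forall>i. coeff f i \<in> M} \<subseteq> N" "\<And>y. y \<notin> N \<Longrightarrow> \<exists>r. 1 - r * y \<in> N"
  obtains h where "lead_coeff h = 1" "h \<in> N"
proof -
  note MI = prime_idealD(1)[OF M]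
  define S where "S = {f \<in> N. \<exists>i. coeff f i \<notin> M}"
  have "S \<noteq> {}"
  proof
    assume S: "S = {}"
    have "coeff [:0, 1:] 1 \<notin> M" using prime_idealD(2)[OF M] by simp
    then have "[:0, 1:] \<notin> N" using S unfolding S_def by blast
    then obtain r where "1 - r * [:0, 1:] \<in> N" using N(3) by blast
    then have "coeff (1 - r * [:0, 1:]) 0 \<in> M" using S unfolding S_def by blast
    then show False using prime_idealD(2)[OF M] by (simp add: coeff_mult_0)
  qed
  then obtain f where f: "f \<in> S" "\<And>g. g \<in> S \<Longrightarrow> degree f \<le> degree g"
    using ex_has_least_nat[of "\<lambda>f. f \<in> S" _ degree] by blast
  define n where "n = degree f"
  have monom: "monom m n \<in> N" if "m \<in> M" for m n
    using that is_ideal_0[OF MI] N(2) by (auto simp: subset_iff)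
  have l: "coeff f n \<notin> M"
  proof
    assume l: "coeff f n \<in> M"
    define g where "g = f - monom (coeff f n) n"
    have "g \<in> N" unfolding g_def using f(1) by (intro is_ideal_diff[OF N(1)] monom l) (simp add: S_def)
    moreover obtain i where i: "coeff f i \<notin> M" using f(1) unfolding S_def by blast
    then have "i \<noteq> n" using l by blast
    then have gi: "coeff g i \<notin> M" unfolding g_def using i by simp
    ultimately have "g \<in> S" unfolding S_def by blast
    then have "n \<le> degree g" using f(2) unfolding n_def by blast
    moreover have "degree g \<le> n" unfolding g_def n_def by (intro degree_diff_le) (auto simp: degree_monom_le)
    ultimately have "degree g = n" by simp
    moreover have "coeff g n = 0" unfolding g_def by simp
    ultimately have "g = 0" using leading_coeff_0_iff by metis
    then show False using gi is_ideal_0[OF MI] by simp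
  qed
  then obtain r where r: "1 - r * coeff f n \<in> M" using M_max by blast
  \<comment> \<open>The leading coefficient of \<open>r * f\<close> is 1 only modulo
    \<open>M\<close>; the monomial corrects it and lies in \<open>M[X]\<close>, hence in
    \<open>N\<close>.\<close>
  define h where "h = [:r:] * f + monom (1 - r * coeff f n) n"
  have hn: "coeff h n = 1" unfolding h_def by simp
  have "degree h \<le> n"
    unfolding h_def by (intro degree_add_le) (simp_all add: degree_monom_le degree_smult_le n_def)
  moreover have "(1::'a) \<noteq> 0" using prime_idealD(2)[OF M] is_ideal_0[OF MI] by metis
  then have "n \<le> degree h" using hn by (intro le_degree) simp
  ultimately have "lead_coeff h = 1" using hn by simp
  moreover have "h \<in> N"
    unfolding h_def using f(1) by (intro is_ideal_add[OF N(1)] is_ideal_mult[OF N(1)] monom r) (simp add: S_def)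
  ultimately show thesis by (rule that)
qed

theorem theorem4p3:
  shows "\<not> (finite_character TYPE('a :: {factorial_semiring, idom}) \<and>
            krull_dim TYPE('a) = 2 \<and>
            radically_finite TYPE('a poly))"
proof
  assume "finite_character TYPE('a) \<and> krull_dim TYPE('a) = 2 \<and> radically_finite TYPE('a poly)"
  then have fc: "finite_character TYPE('a)" and dim: "krull_dim TYPE('a) = 2"
    and rf: "radically_finite TYPE('a poly)" by blast+
  obtain M :: "'a set" and q c where M: "prime_ideal M" and M_max: "\<And>y. y \<notin> M \<Longrightarrow> \<exists>r. 1 - r * y \<in> M"
    and q: "prime_elem q" "\<not> q dvd c" and rad: "M = rad (ideal2 q c)"
    using two_dimensional_maximal_ideal[OF fc dim] by blast
  note MI = prime_idealD(1)[OF M] and M1 = prime_idealD(2)[OF M]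
  have "ideal2 q c \<subseteq> M" unfolding rad rad_def by (auto intro: exI[of _ 1])
  then have qc: "q \<in> M" "c \<in> M" using ideal2_gens by blast+
  define N0 where "N0 = {f :: 'a poly. coeff f 0 \<in> M}"
  have N0: "prime_ideal N0" unfolding N0_def by (rule prime_ideal_const_coeff[OF M])
  obtain \<theta> where "rad N0 = rad (gen_by 3 \<theta>)"
    using rad_const_coeff_three_generated[OF M rad] unfolding N0_def by (rule exE)
  moreover have "radically_perfect N0" using rf N0 unfolding radically_finite_def by blast
  ultimately have ht: "ht P \<le> 2" if "prime_ideal P" "P \<subset> N0" for P
    using ht_le_2_of_psubset that by blast
  have X: "[:0, 1:] \<in> N0" unfolding N0_def using is_ideal_0[OF MI] by simp
  define MX where "MX = {f :: 'a poly. \<forall>i. coeff f i \<in> M}"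
  have MX: "prime_ideal MX" unfolding MX_def by (rule prime_ideal_coeffs[OF M])
  have constMX: "[:x:] \<in> MX" if "x \<in> M" for x
    unfolding MX_def using that is_ideal_0[OF MI] by (auto simp: coeff_pCons split: nat.splits)
  have "coeff [:0, 1:] 1 \<notin> M" using M1 by simp
  then have "[:0, 1:] \<notin> MX" unfolding MX_def by blast
  then have "MX \<subset> N0" using X unfolding MX_def N0_def by blast
  note MX_ht = ht[OF MX this]
  have reg: "reg_pair ([:q:] ^ k) ([:c:] ^ l)" for k l
    using q by (intro prime_elem_imp_reg_pair lift_prime_elem_poly) simp_all
  obtain f g where fg: "MX = ideal2 f g"
  proof (rule radically_finite_two_generated[OF rf MX MX_ht constMX[OF qc(1)] constMX[OF qc(2)] reg])
    fix N :: "'a poly set"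
    assume N: "is_ideal N" "MX \<subseteq> N" "\<And>y. y \<notin> N \<Longrightarrow> \<exists>r. 1 - r * y \<in> N"
    obtain h where "lead_coeff h = 1" "h \<in> N"
      using monic_in_ideal_over_coeffs[OF M M_max N(1) N(2)[unfolded MX_def] N(3)] by blast
    then show "\<exists>p c h. prime_elem p \<and> \<not> p dvd c \<and> lead_coeff h = 1 \<and> [:p:] \<in> N \<and> [:c:] \<in> N \<and> h \<in> N"
      using q constMX[OF qc(1)] constMX[OF qc(2)] N(2) by blast
  qed
  \<comment> \<open>Setting \<open>X = 0\<close> in the two generators of \<open>M[X]\<close> gives
    generators of \<open>M\<close>.\<close>
  define a b where "a = coeff f 0" and "b = coeff g 0"
  have M_eq: "M = ideal2 a b"
  proof
    show "M \<subseteq> ideal2 a b"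
    proof
      fix x assume "x \<in> M"
      then have "[:x:] \<in> ideal2 f g" using constMX fg by blast
      then obtain u v where "[:x:] = u * f + v * g" by (rule ideal2E)
      from arg_cong[OF this, of "\<lambda>q. coeff q 0"] show "x \<in> ideal2 a b"
        unfolding a_def b_def by (intro ideal2I) (simp add: coeff_mult_0)
    qed
    have "f \<in> MX" "g \<in> MX" unfolding fg by (rule ideal2_gens)+
    then show "ideal2 a b \<subseteq> M" unfolding MX_def a_def b_def by (intro ideal2_least[OF MI]) blast+
  qed
  have regR: "reg_pair q c" using prime_elem_imp_reg_pair[OF q, of 1 1] by simp
  have a0: "a \<noteq> 0"
  proof
    assume a: "a = 0"
    obtain \<alpha> \<beta> where "q = \<alpha> * a + \<beta> * b" using qc(1) unfolding M_eq by (rule ideal2E)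
    then have 1: "q = \<beta> * b" using a by simp
    obtain \<gamma> \<delta> where "c = \<gamma> * a + \<delta> * b" using qc(2) unfolding M_eq by (rule ideal2E)
    then have "c = \<delta> * b" using a by simp
    with 1 regR have "b dvd 1" using reg_pair_multiples by metis
    then obtain k where "1 = b * k" by (elim dvdE)
    moreover have "b * k \<in> M" by (rule is_ideal_mult2[OF MI]) (simp add: M_eq ideal2_gens)
    ultimately show False using M1 by simp
  qed
  interpret regular_maximal_ideal M a b
  proof
    fix u v assume "u * a + v * b = 0"
    then obtain w where "v = w * a" "u = - (w * b)"
      using reg_pair_syzygy[OF regR qc[unfolded M_eq] a0] by blast
    then show "\<exists>w. v = w * a \<and> u = - (w * b)" by blast
  qed (use M_eq M1 M_max in blast)+
  \<comment> \<open>Otherwise it would be the product of two elements of \<open>M\<close>, namely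
    \<open>0 * 0\<close>.\<close>
  have "a ^ 4 - b ^ 3 \<noteq> 0" using cusp_no_factor[of 0 0] is_ideal_0[OF MI] by auto
  moreover have "a ^ 4 - b ^ 3 = a ^ 3 * a - b ^ 2 * b" by (simp add: power2_eq_square power3_eq_cube power4_eq_xxxx)
  then have "a ^ 4 - b ^ 3 \<in> M"
    using is_ideal_diff[OF MI is_ideal_mult[OF MI a_in_M] is_ideal_mult[OF MI b_in_M]] by simp
  ultimately obtain p where p: "prime_elem p" "p dvd a ^ 4 - b ^ 3" "p \<in> M"
    using prime_ideal_contains_prime_elem[OF M] by blast
  obtain h where h: "a ^ 4 - b ^ 3 = p * h" using p(2) by (elim dvdE)
  have hM: "h \<notin> M" using cusp_no_factor[OF h[symmetric] p(3)] by blast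
  note pb = prime_factor_not_dvd(2)[OF p(1,3,2)]
  define P where "P = eval_kernel p b (a ^ 3)"
  have P: "prime_ideal P" unfolding P_def by (rule prime_ideal_eval_kernel[OF p(1) pb])
  note coeffs = eval_kernel_coeffs[OF p(1,3) h hM, folded P_def]
  have "[:0, 1:] \<notin> P" using coeffs(2)[of "[:0, 1:]"] M1 by auto
  moreover have "P \<subseteq> N0" unfolding N0_def using coeffs(1) M2_subset_M by blast
  ultimately have "P \<subset> N0" using X by blast
  note P_ht = ht[OF P this]
  \<comment> \<open>\<open>t\<close> serves twice: with the constant \<open>p\<close> it forms the
    regular pair in \<open>P\<close>, and it is the monic third term of the regular
    sequence.\<close>
  define t where "t = [:- (a ^ 2 * b), 0, 1:]"
  have "(a ^ 3) ^ 2 + (- (a ^ 2 * b)) * b ^ 2 = a ^ 2 * (a ^ 4 - b ^ 3)"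
    by (simp add: algebra_simps flip: power_add power_mult power_Suc2 power_Suc)
  then have t: "t \<in> P"
    unfolding t_def P_def square_in_eval_kernel_iff[OF p(1) pb] using p(2) by simp
  have pP: "[:p:] \<in> P" unfolding P_def by (rule const_in_eval_kernel[OF p(1) pb])
  have "\<not> [:p:] dvd t"
  proof
    assume "[:p:] dvd t"
    then have "p dvd coeff t 2" unfolding const_poly_dvd_iff by blast
    then show False using p(1) unfolding t_def prime_elem_def by (simp add: numeral_2_eq_2)
  qed
  then have reg: "reg_pair ([:p:] ^ k) (t ^ l)" for k l
    by (intro prime_elem_imp_reg_pair lift_prime_elem_poly p(1))
  obtain f' g' where "P = ideal2 f' g'"
  proof (rule radically_finite_two_generated[OF rf P P_ht pP t reg])
    fix N :: "'a poly set"
    assume N: "is_ideal N" "P \<subseteq> N" "\<And>y. y \<notin> N \<Longrightarrow> \<exists>r. 1 - r * y \<in> N"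
    obtain c where "\<not> p dvd c" "[:c:] \<in> N"
      using eval_kernel_maximal_over[OF p(1,3,2) N(1) N(2)[unfolded P_def] N(3)] by blast
    moreover have "lead_coeff t = 1" unfolding t_def by simp
    ultimately show "\<exists>p c h. prime_elem p \<and> \<not> p dvd c \<and> lead_coeff h = 1 \<and> [:p:] \<in> N \<and> [:c:] \<in> N \<and> h \<in> N"
      using p(1) pP t N(2) by blast
  qed
  then show False using eval_kernel_not_two_generated[OF p(1,3) h hM] unfolding P_def by blast
qed

end
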